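(* Consider the status updating system described in the context, operating under the highest $k$ selective encoding scheme for some $k\in\{1,\dots,n\}$ with arrival rate $\lambda>0$ and codeword lengths $\ell(x_1),\dots,\ell(x_k)$. Then the long term average age at the receiver node is $$\Delta=\frac{\mathbb{E}[L^2]+\frac{2}{q_k\lambda}\mathbb{E}[L]+\frac{2}{(q_k\lambda)^2}}{2\left(\mathbb{E}[L]+\frac{1}{q_k\lambda}\right)}+\mathbb{E}[L],$$ where $q_k=\sum_{\ell=1}^k P_X(x_\ell)$, $\mathbb{E}[L]=\sum_{i=1}^k P_{X_k}(x_i)\ell(x_i)$ and $\mathbb{E}[L^2]=\sum_{i=1}^k P_{X_k}(x_i)\ell(x_i)^2$.
   Context: An information source generates status update packets whose arrival times at a transmitter node form a Poisson process of rate $\lambda>0$. Each packet carries an independent realization of a random variable $X$ taking values in $\{x_1,\dots,x_n\}$ with known pmf $P_X$, where $P_X(x_m)\ge P_X(x_j)$ for all $m\le j$; realizations are independent of the arrival process. Highest $k$ selective encoding: only realizations in $\{x_1,\dots,x_k\}$ are encoded, realization $x_i$ ($i\le k$) being assigned a binary codeword of length $\ell(x_i)$. The transmitter uses a blocking policy: packets arriving while the transmitter is busy are discarded. When an idle transmitter receives a packet whose realization is $x_i$ with $i\le k$, it transmits the codeword over an error-free channel at one bit per unit time, so the transmission (service) takes $\ell(x_i)$ time units, after which the receiver obtains the update and the transmitter becomes idle; if the realization is $x_i$ with $i>k$, the packet is discarded and the transmitter keeps waiting for the next arrival. Define $q_k=\sum_{\ell=1}^k P_X(x_\ell)$ and the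 conditional pmf $P_{X_k}(x_i)=P_X(x_i)/q_k$ for $i\le k$ and $P_{X_k}(x_i)=0$ for $i>k$. The instantaneous age at the receiver is $\Delta(t)=t-u(t)$, where $u(t)$ is the generation (arrival) time of the most recently received update, and the long term average age is $\Delta=\lim_{T\to\infty}\frac1T\int_0^T\Delta(t)\,dt$. *)

theory Defs
  imports "HOL-Probability.Probability"
begin

text \<open>Sample-path model of the highest-k selective encoding status update system.
  Packet j (j = 0,1,2,...) has interarrival time IA j (so it arrives at time
  arrival IA j = IA 0 + ... + IA j) and realization index Xr j (meaning x_(Xr j)).
  Codeword lengths: len i for realization x_i.  The transmitter starts idle at time 0.\<close>

definition arrival :: "(nat \<Rightarrow> real) \<Rightarrow> nat \<Rightarrow> real" where
  "arrival IA j = (\<Sum>i\<le>j. IA i)"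

text \<open>busy_until k len IA Xr j: time at which the transmitter becomes idle,
  considering packets 0..j-1 only. Packet j is served iff it is encoded
  (index in 1..k) and the transmitter is idle at its arrival.\<close>
fun busy_until :: "nat \<Rightarrow> (nat \<Rightarrow> nat) \<Rightarrow> (nat \<Rightarrow> real) \<Rightarrow> (nat \<Rightarrow> nat) \<Rightarrow> nat \<Rightarrow> real" where
  "busy_until k len IA Xr 0 = 0"
| "busy_until k len IA Xr (Suc j) =
     (if 1 \<le> Xr j \<and> Xr j \<le> k \<and> busy_until k len IA Xr j \<le> arrival IA j
      then arrival IA j + real (len (Xr j))
      else busy_until k len IA Xr j)"

definition served :: "nat \<Rightarrow> (nat \<Rightarrow> nat) \<Rightarrow> (nat \<Rightarrow> real) \<Rightarrow> (nat \<Rightarrow> nat) \<Rightarrow> nat \<Rightarrow> bool" where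
  "served k len IA Xr j \<longleftrightarrow>
     1 \<le> Xr j \<and> Xr j \<le> k \<and> busy_until k len IA Xr j \<le> arrival IA j"

definition last_gen :: "nat \<Rightarrow> (nat \<Rightarrow> nat) \<Rightarrow> (nat \<Rightarrow> real) \<Rightarrow> (nat \<Rightarrow> nat) \<Rightarrow> real \<Rightarrow> real" where
  "last_gen k len IA Xr t =
     (let R = {arrival IA j | j. served k len IA Xr j \<and> arrival IA j + real (len (Xr j)) \<le> t}
      in if R = {} then 0 else Max R)"

definition age :: "nat \<Rightarrow> (nat \<Rightarrow> nat) \<Rightarrow> (nat \<Rightarrow> real) \<Rightarrow> (nat \<Rightarrow> nat) \<Rightarrow> real \<Rightarrow> real" where
  "age k len IA Xr t = t - last_gen k len IA Xr t"

end

theory Submission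
  imports Defs "HOL-Library.Discrete_Functions"
begin

text \<open>
  Observe the system at the epochs at which the transmitter has finished all work brought by the
  packets seen so far. Between consecutive epochs the age grows linearly, and the pair (residual
  service time, age at the epoch) is a Markov chain driven by the i.i.d. pairs of interarrival time
  and realization. Let \<open>m = E[L] + 1/(q\<lambda>)\<close> be the mean cycle length and \<open>\<Delta>\<close> the claimed limit. By the
  memoryless property, the increment
  \<open>(area under the age) - \<Delta> * (elapsed time) + m * (change of the age at the epochs)\<close>
  has conditional mean zero for every state. Hence these increments are orthogonal; their second
  moments are bounded, so their averages tend to zero almost surely, and the age term telescopes
  to something negligible. No embedded renewal sequence is needed.
\<close>

section \<open>A strong law for orthogonal random variables\<close>

text \<open>Indexing by arriving packets instead of delivered updates keeps the index deterministic:
  each input is independent of the state it meets, so no stopping times occur. The price is a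
  residual service time \<open>r\<close> carried in the state. The weight \<open>m\<close> on the
  age change solves a Poisson equation for the chain. An arrival during a service contributes
  nothing. Given that the next arrival falls after the service ends (probability
  \<open>exp (- lam * r)\<close>), the mean gap is \<open>1 / lam + q * EL = q * m\<close>, whatever
  the state. The area contains the current age \<open>x\<close> times this gap, while with
  probability \<open>q\<close> an encodable packet removes \<open>x\<close> from the age; the terms
  linear in \<open>x\<close> therefore cancel precisely for the weight \<open>m\<close>. The rest
  vanishes precisely when \<open>\<Delta> * m = EL2 / 2 + m\<^sup>2\<close>, which fixes the limit.
  The obstacle is that the age is unbounded and does not contract at every step. Since the
  increments grow only linearly in the age, uniform second moments of the age are enough.\<close>

lemma AE_tendsto_0_second_moment:
  fixes Y :: "nat \<Rightarrow> 'a \<Rightarrow> real"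
  assumes [measurable]: "\<And>n. Y n \<in> borel_measurable M"
    and int: "\<And>n. integrable M (\<lambda>\<omega>. (Y n \<omega>)\<^sup>2)"
    and le: "\<And>n. (\<integral>\<omega>. (Y n \<omega>)\<^sup>2 \<partial>M) \<le> c n"
    and c: "summable c"
  shows "AE \<omega> in M. (\<lambda>n. Y n \<omega>) \<longlonglongrightarrow> 0"
proof -
  have c0: "c n \<ge> 0" for n
    by (rule order_trans[OF _ le]) simp
  \<comment> \<open>The squares have a finite expected sum, so their series converges almost surely
    and its terms tend to zero. This replaces Chebyshev plus Borel-Cantelli.\<close>
  have "(\<integral>\<^sup>+\<omega>. (\<Sum>n. ennreal ((Y n \<omega>)\<^sup>2)) \<partial>M) = (\<Sum>n. \<integral>\<^sup>+\<omega>. ennreal ((Y n \<omega>)\<^sup>2) \<partial>M)"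
    by (rule nn_integral_suminf) measurable
  also have "\<dots> = (\<Sum>n. ennreal (\<integral>\<omega>. (Y n \<omega>)\<^sup>2 \<partial>M))"
    by (intro suminf_cong nn_integral_eq_integral int) simp
  also have "\<dots> \<le> (\<Sum>n. ennreal (c n))"
    by (intro suminf_le ennreal_leI le) auto
  also have "\<dots> = ennreal (\<Sum>n. c n)"
    using c0 c by (rule suminf_ennreal2)
  also have "\<dots> < \<infinity>" by simp
  finally have "AE \<omega> in M. (\<Sum>n. ennreal ((Y n \<omega>)\<^sup>2)) \<noteq> \<infinity>"
    by (intro nn_integral_PInf_AE) auto
  then show ?thesis
  proof eventually_elim
    case (elim \<omega>)
    then have "summable (\<lambda>n. (Y n \<omega>)\<^sup>2)"
      by (intro summable_suminf_not_top) (auto simp: top_unique)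
    then have "(\<lambda>n. (Y n \<omega>)\<^sup>2) \<longlonglongrightarrow> 0"
      by (rule summable_LIMSEQ_zero)
    then have "(\<lambda>n. sqrt ((Y n \<omega>)\<^sup>2)) \<longlonglongrightarrow> sqrt 0"
      by (rule tendsto_real_sqrt)
    then show ?case
      by (simp add: tendsto_rabs_zero_iff)
  qed
qed

lemma summable_const_over_square: "summable (\<lambda>n. C / (real n)\<^sup>2)"
  using summable_mult[OF inverse_power_summable[of 2, where 'a=real], of C]
  by (simp add: divide_inverse)

lemma integrable_mult_of_squares:
  fixes f g :: "'a \<Rightarrow> real"
  assumes [measurable]: "f \<in> borel_measurable M" "g \<in> borel_measurable M"
    and "integrable M (\<lambda>\<omega>. (f \<omega>)\<^sup>2)" "integrable M (\<lambda>\<omega>. (g \<omega>)\<^sup>2)"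
  shows "integrable M (\<lambda>\<omega>. f \<omega> * g \<omega>)"
proof (rule Bochner_Integration.integrable_bound)
  show "integrable M (\<lambda>\<omega>. (f \<omega>)\<^sup>2 + (g \<omega>)\<^sup>2)"
    using assms by simp
  show "AE \<omega> in M. norm (f \<omega> * g \<omega>) \<le> norm ((f \<omega>)\<^sup>2 + (g \<omega>)\<^sup>2)"
  proof (intro AE_I2)
    fix \<omega>
    have "2 * (\<bar>f \<omega>\<bar> * \<bar>g \<omega>\<bar>) \<le> (f \<omega>)\<^sup>2 + (g \<omega>)\<^sup>2"
      using sum_squares_bound[of "\<bar>f \<omega>\<bar>" "\<bar>g \<omega>\<bar>"] by simp
    moreover have "0 \<le> \<bar>f \<omega>\<bar> * \<bar>g \<omega>\<bar>" by simp
    ultimately show "norm (f \<omega> * g \<omega>) \<le> norm ((f \<omega>)\<^sup>2 + (g \<omega>)\<^sup>2)"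
      unfolding real_norm_def abs_mult by linarith
  qed
qed measurable

text \<open>Pythagoras: the cross terms integrate to zero one by one. Both claims share one
  induction because splitting the integral in the second one uses the first.\<close>

lemma integral_square_sum_orthogonal:
  fixes \<xi> :: "nat \<Rightarrow> 'a \<Rightarrow> real"
  assumes [measurable]: "\<And>j. \<xi> j \<in> borel_measurable M"
    and int: "\<And>j. integrable M (\<lambda>\<omega>. (\<xi> j \<omega>)\<^sup>2)"
    and orth: "\<And>i j. i < j \<Longrightarrow> (\<integral>\<omega>. \<xi> i \<omega> * \<xi> j \<omega> \<partial>M) = 0"
  shows "integrable M (\<lambda>\<omega>. (\<Sum>j<N. \<xi> j \<omega>)\<^sup>2)"
    and "(\<integral>\<omega>. (\<Sum>j<N. \<xi> j \<omega>)\<^sup>2 \<partial>M) = (\<Sum>j<N. \<integral>\<omega>. (\<xi> j \<omega>)\<^sup>2 \<partial>M)"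
proof (induction N)
  case (Suc N)
  have prod: "integrable M (\<lambda>\<omega>. \<xi> i \<omega> * \<xi> N \<omega>)" for i
    by (intro integrable_mult_of_squares int) auto
  have eq: "(\<Sum>j<Suc N. \<xi> j \<omega>)\<^sup>2 =
      (\<Sum>j<N. \<xi> j \<omega>)\<^sup>2 + 2 * (\<Sum>j<N. \<xi> j \<omega> * \<xi> N \<omega>) + (\<xi> N \<omega>)\<^sup>2" for \<omega>
    by (simp add: power2_sum flip: sum_distrib_right)
  {
    case 1
    show ?case
      unfolding eq using Suc.IH(1) prod int by (intro Bochner_Integration.integrable_add) auto
  next
    case 2
    have "(\<integral>\<omega>. (\<Sum>j<Suc N. \<xi> j \<omega>)\<^sup>2 \<partial>M) =
        (\<integral>\<omega>. (\<Sum>j<N. \<xi> j \<omega>)\<^sup>2 \<partial>M) + 2 * (\<Sum>j<N. \<integral>\<omega>. \<xi> j \<omega> * \<xi> N \<omega> \<partial>M) + (\<integral>\<omega>. (\<xi> N \<omega>)\<^sup>2 \<partial>M)"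
      unfolding eq using Suc.IH(1) prod int by simp
    then show ?case
      using Suc.IH(2) orth by simp
  }
qed simp_all

text \<open>The partial sums are controlled along squares by their variance, and between consecutive squares
  by the crude Cauchy--Schwarz bound on the \<open>2 m + 1\<close> intermediate terms.\<close>

lemma strong_law_orthogonal:
  fixes \<xi> :: "nat \<Rightarrow> 'a \<Rightarrow> real"
  assumes [measurable]: "\<And>j. \<xi> j \<in> borel_measurable M"
    and int: "\<And>j. integrable M (\<lambda>\<omega>. (\<xi> j \<omega>)\<^sup>2)"
    and le: "\<And>j. (\<integral>\<omega>. (\<xi> j \<omega>)\<^sup>2 \<partial>M) \<le> C"
    and orth: "\<And>i j. i < j \<Longrightarrow> (\<integral>\<omega>. \<xi> i \<omega> * \<xi> j \<omega> \<partial>M) = 0"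
  shows "AE \<omega> in M. (\<lambda>N. (\<Sum>j<N. \<xi> j \<omega>) / real N) \<longlonglongrightarrow> 0"
proof -
  define Y where "Y m \<omega> = (\<Sum>j<m\<^sup>2. \<xi> j \<omega>) / (real m)\<^sup>2" for m \<omega>
  define R where "R m \<omega> = (\<Sum>j\<in>{m\<^sup>2..<(Suc m)\<^sup>2}. \<bar>\<xi> j \<omega>\<bar>) / (real m)\<^sup>2" for m \<omega>
  have C0: "C \<ge> 0"
    by (rule order_trans[OF _ le[of 0]]) simp
  have [measurable]: "Y m \<in> borel_measurable M" "R m \<in> borel_measurable M" for m
    unfolding Y_def R_def by measurable
  have Y: "AE \<omega> in M. (\<lambda>m. Y m \<omega>) \<longlonglongrightarrow> 0"
  proof (rule AE_tendsto_0_second_moment[where c="\<lambda>m. C / (real m)\<^sup>2"])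
    fix m
    show "integrable M (\<lambda>\<omega>. (Y m \<omega>)\<^sup>2)"
      unfolding Y_def power_divide
      by (intro integrable_divide_zero integral_square_sum_orthogonal int orth) auto
    have "(\<integral>\<omega>. (Y m \<omega>)\<^sup>2 \<partial>M) = (\<Sum>j<m\<^sup>2. \<integral>\<omega>. (\<xi> j \<omega>)\<^sup>2 \<partial>M) / (real m)^4"
      unfolding Y_def power_divide
      by (simp add: integral_square_sum_orthogonal(2)[OF _ int orth])
    also have "\<dots> \<le> (\<Sum>j<m\<^sup>2. C) / (real m)^4"
      by (intro divide_right_mono sum_mono le) auto
    also have "\<dots> = C / (real m)\<^sup>2"
      by (cases "m = 0") (auto simp: field_simps power_numeral_reduce)
    finally show "(\<integral>\<omega>. (Y m \<omega>)\<^sup>2 \<partial>M) \<le> C / (real m)\<^sup>2" .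
  qed (auto simp: summable_const_over_square)
  have R: "AE \<omega> in M. (\<lambda>m. R m \<omega>) \<longlonglongrightarrow> 0"
  proof (rule AE_tendsto_0_second_moment[where c="\<lambda>m. (9 * C) / (real m)\<^sup>2"])
    fix m
    let ?J = "{m\<^sup>2..<(Suc m)\<^sup>2}"
    have card: "card ?J = 2 * m + 1"
      by (simp add: power2_eq_square)
    have pw: "(R m \<omega>)\<^sup>2 \<le> real (2 * m + 1) * (\<Sum>j\<in>?J. (\<xi> j \<omega>)\<^sup>2) / (real m)^4" for \<omega>
    proof -
      have "(\<Sum>j\<in>?J. \<bar>\<xi> j \<omega>\<bar> * 1)\<^sup>2 \<le> (\<Sum>j\<in>?J. \<bar>\<xi> j \<omega>\<bar>\<^sup>2) * (\<Sum>j\<in>?J. 1\<^sup>2)"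
        by (rule Cauchy_Schwarz_ineq_sum)
      then have "(\<Sum>j\<in>?J. \<bar>\<xi> j \<omega>\<bar>)\<^sup>2 \<le> real (2 * m + 1) * (\<Sum>j\<in>?J. (\<xi> j \<omega>)\<^sup>2)"
        unfolding power_one sum_constant card by (simp add: mult.commute)
      moreover have "(R m \<omega>)\<^sup>2 = (\<Sum>j\<in>?J. \<bar>\<xi> j \<omega>\<bar>)\<^sup>2 / (real m)^4"
        by (simp add: R_def power_divide)
      ultimately show ?thesis
        by (simp only: divide_right_mono zero_le_power of_nat_0_le_iff)
    qed
    have bound_int: "integrable M (\<lambda>\<omega>. real (2 * m + 1) * (\<Sum>j\<in>?J. (\<xi> j \<omega>)\<^sup>2) / (real m)^4)"
      by (intro integrable_divide_zero integrable_mult_right Bochner_Integration.integrable_sum int)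
    show Rint: "integrable M (\<lambda>\<omega>. (R m \<omega>)\<^sup>2)"
      using pw by (intro Bochner_Integration.integrable_bound[OF bound_int] AE_I2) (auto simp: sum_nonneg)
    have "(\<integral>\<omega>. (R m \<omega>)\<^sup>2 \<partial>M) \<le> (\<integral>\<omega>. real (2 * m + 1) * (\<Sum>j\<in>?J. (\<xi> j \<omega>)\<^sup>2) / (real m)^4 \<partial>M)"
      by (intro integral_mono Rint bound_int pw)
    also have "\<dots> = real (2 * m + 1) * (\<Sum>j\<in>?J. \<integral>\<omega>. (\<xi> j \<omega>)\<^sup>2 \<partial>M) / (real m)^4"
      using int by simp
    also have "\<dots> \<le> real (2 * m + 1) * (\<Sum>j\<in>?J. C) / (real m)^4"
      by (intro divide_right_mono mult_left_mono sum_mono le) auto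
    also have "\<dots> = C * (real (2 * m + 1))\<^sup>2 / (real m)^4"
      by (simp only: sum_constant card) (simp add: power2_eq_square mult_ac)
    \<comment> \<open>For \<open>m > 0\<close> the estimate \<open>2 * m + 1 \<le> 3 * m\<close>
      gives the 9; for \<open>m = 0\<close> both sides are 0 by the convention for division by
      zero.\<close>
    also have "\<dots> \<le> (9 * C) / (real m)\<^sup>2"
    proof (cases "m = 0")
      case False
      then have "(real (2 * m + 1))\<^sup>2 \<le> (3 * real m)\<^sup>2"
        by (intro power_mono) auto
      then have "C * (real (2 * m + 1))\<^sup>2 \<le> C * (3 * real m)\<^sup>2"
        using C0 by (rule mult_left_mono)
      then have "C * (real (2 * m + 1))\<^sup>2 / (real m)^4 \<le> C * (3 * real m)\<^sup>2 / (real m)^4"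
        by (rule divide_right_mono) simp
      also have "\<dots> = (9 * C) / (real m)\<^sup>2"
        using False by (simp add: field_simps power_numeral_reduce)
      finally show ?thesis .
    qed simp
    finally show "(\<integral>\<omega>. (R m \<omega>)\<^sup>2 \<partial>M) \<le> (9 * C) / (real m)\<^sup>2" .
  qed (auto simp: summable_const_over_square)
  have sqrt_lim: "filterlim floor_sqrt at_top sequentially"
    unfolding filterlim_at_top
  proof
    fix m
    show "eventually (\<lambda>N. m \<le> floor_sqrt N) sequentially"
      using eventually_ge_at_top[of "m\<^sup>2"]
    proof eventually_elim
      case (elim N)
      then show ?case
        using mono_floor_sqrt'[of "m\<^sup>2" N] by simp
    qed
  qed
  show ?thesis
    using Y R
  proof eventually_elim
    case (elim \<omega>)
    have "(\<lambda>m. \<bar>Y m \<omega>\<bar> + R m \<omega>) \<longlonglongrightarrow> 0"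
      using tendsto_add[OF tendsto_rabs_zero[OF elim(1)] elim(2)] by simp
    then have lim: "(\<lambda>N. \<bar>Y (floor_sqrt N) \<omega>\<bar> + R (floor_sqrt N) \<omega>) \<longlonglongrightarrow> 0"
      using sqrt_lim by (rule filterlim_compose)
    show ?case
    proof (rule Lim_null_comparison[OF _ lim])
      show "\<forall>\<^sub>F N in sequentially. norm ((\<Sum>j<N. \<xi> j \<omega>) / real N) \<le>
          \<bar>Y (floor_sqrt N) \<omega>\<bar> + R (floor_sqrt N) \<omega>"
        using eventually_gt_at_top[of 0]
      proof eventually_elim
        case (elim N)
        define m where "m = floor_sqrt N"
        have m: "m\<^sup>2 \<le> N" "N < (Suc m)\<^sup>2" "m > 0"
          using elim Suc_floor_sqrt_power2_gt[of N] by (auto simp: m_def)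
        have "{..<N} = {..<m\<^sup>2} \<union> {m\<^sup>2..<N}"
          using m by auto
        then have "(\<Sum>j<N. \<xi> j \<omega>) = (\<Sum>j<m\<^sup>2. \<xi> j \<omega>) + (\<Sum>j\<in>{m\<^sup>2..<N}. \<xi> j \<omega>)"
          by (simp add: sum.union_disjoint ivl_disj_int)
        moreover have "\<bar>\<Sum>j\<in>{m\<^sup>2..<N}. \<xi> j \<omega>\<bar> \<le> (\<Sum>j\<in>{m\<^sup>2..<N}. \<bar>\<xi> j \<omega>\<bar>)"
          by (rule sum_abs)
        moreover have "\<dots> \<le> (\<Sum>j\<in>{m\<^sup>2..<(Suc m)\<^sup>2}. \<bar>\<xi> j \<omega>\<bar>)"
          using m by (intro sum_mono2) auto
        ultimately have "\<bar>\<Sum>j<N. \<xi> j \<omega>\<bar> \<le>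
            \<bar>\<Sum>j<m\<^sup>2. \<xi> j \<omega>\<bar> + (\<Sum>j\<in>{m\<^sup>2..<(Suc m)\<^sup>2}. \<bar>\<xi> j \<omega>\<bar>)"
          by linarith
        moreover have "real N \<ge> (real m)\<^sup>2"
          using m(1) by (metis of_nat_mono of_nat_power)
        ultimately have "\<bar>\<Sum>j<N. \<xi> j \<omega>\<bar> / real N \<le>
            (\<bar>\<Sum>j<m\<^sup>2. \<xi> j \<omega>\<bar> + (\<Sum>j\<in>{m\<^sup>2..<(Suc m)\<^sup>2}. \<bar>\<xi> j \<omega>\<bar>)) / (real m)\<^sup>2"
          using m(3) by (intro frac_le) auto
        then show ?case
          by (simp add: Y_def R_def m_def add_divide_distrib abs_divide)
      qed
    qed
  qed
qed

section \<open>Recursions driven by independent inputs\<close>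

context prob_space
begin

text \<open>Fubini for the product law of an independent pair, pulled back to \<open>M\<close>: the
  inner integral runs over an independent copy \<open>\<omega>'\<close> with the first argument
  frozen. It stands in for conditioning on \<open>A\<close>.\<close>

lemma indep_var_nn_integral_iterated:
  assumes ind: "indep_var N A K B" and [measurable]: "h \<in> borel_measurable (N \<Otimes>\<^sub>M K)"
  shows "(\<integral>\<^sup>+\<omega>. h (A \<omega>, B \<omega>) \<partial>M) = (\<integral>\<^sup>+\<omega>. \<integral>\<^sup>+\<omega>'. h (A \<omega>, B \<omega>') \<partial>M \<partial>M)"
proof -
  have [measurable]: "A \<in> measurable M N" "B \<in> measurable M K"
    using ind by (auto dest: indep_var_rv1 indep_var_rv2)
  interpret B: prob_space "distr M K B"
    by (rule prob_space_distr) simp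
  have "(\<integral>\<^sup>+\<omega>. h (A \<omega>, B \<omega>) \<partial>M) = (\<integral>\<^sup>+p. h p \<partial>distr M (N \<Otimes>\<^sub>M K) (\<lambda>\<omega>. (A \<omega>, B \<omega>)))"
    by (simp add: nn_integral_distr)
  also have "\<dots> = (\<integral>\<^sup>+p. h p \<partial>(distr M N A \<Otimes>\<^sub>M distr M K B))"
    using ind by (simp add: indep_var_distribution_eq)
  also have "\<dots> = (\<integral>\<^sup>+a. \<integral>\<^sup>+b. h (a, b) \<partial>distr M K B \<partial>distr M N A)"
    by (rule B.nn_integral_fst[symmetric]) simp
  also have "\<dots> = (\<integral>\<^sup>+\<omega>. \<integral>\<^sup>+\<omega>'. h (A \<omega>, B \<omega>') \<partial>M \<partial>M)"
    by (subst nn_integral_distr)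
       (auto intro!: nn_integral_cong nn_integral_distr dest: measurable_space[OF \<open>A \<in> measurable M N\<close>])
  finally show ?thesis .
qed

lemma indep_var_integral_iterated:
  fixes h :: "'b \<times> 'b \<Rightarrow> real"
  assumes ind: "indep_var N A K B" and [measurable]: "h \<in> borel_measurable (N \<Otimes>\<^sub>M K)"
    and int: "integrable M (\<lambda>\<omega>. h (A \<omega>, B \<omega>))"
  shows "(\<integral>\<omega>. h (A \<omega>, B \<omega>) \<partial>M) = (\<integral>\<omega>. \<integral>\<omega>'. h (A \<omega>, B \<omega>') \<partial>M \<partial>M)"
proof -
  have [measurable]: "A \<in> measurable M N" "B \<in> measurable M K"
    using ind by (auto dest: indep_var_rv1 indep_var_rv2)
  interpret A: prob_space "distr M N A"
    by (rule prob_space_distr) simp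
  interpret B: prob_space "distr M K B"
    by (rule prob_space_distr) simp
  interpret AB: pair_sigma_finite "distr M N A" "distr M K B" ..
  have dist: "distr M (N \<Otimes>\<^sub>M K) (\<lambda>\<omega>. (A \<omega>, B \<omega>)) = distr M N A \<Otimes>\<^sub>M distr M K B"
    using ind by (simp add: indep_var_distribution_eq)
  have "(\<integral>\<omega>. h (A \<omega>, B \<omega>) \<partial>M) = (\<integral>p. h p \<partial>distr M (N \<Otimes>\<^sub>M K) (\<lambda>\<omega>. (A \<omega>, B \<omega>)))"
    by (simp add: integral_distr)
  also have "\<dots> = (\<integral>p. h p \<partial>(distr M N A \<Otimes>\<^sub>M distr M K B))"
    by (simp add: dist)
  also have "\<dots> = (\<integral>a. \<integral>b. h (a, b) \<partial>distr M K B \<partial>distr M N A)"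
  proof (rule AB.integral_fst'[symmetric])
    show "integrable (distr M N A \<Otimes>\<^sub>M distr M K B) h"
      unfolding dist[symmetric] using int by (simp add: integrable_distr_eq)
  qed
  also have "\<dots> = (\<integral>\<omega>. \<integral>b. h (A \<omega>, b) \<partial>distr M K B \<partial>M)"
    by (rule integral_distr) measurable
  also have "\<dots> = (\<integral>\<omega>. \<integral>\<omega>'. h (A \<omega>, B \<omega>') \<partial>M \<partial>M)"
    by (intro Bochner_Integration.integral_cong refl integral_distr)
       (auto dest: measurable_space[OF \<open>A \<in> measurable M N\<close>])
  finally show ?thesis .
qed

text \<open>The present input enters as a family restricted to \<open>{j}\<close>, so that past and
  present are variables of the same type, as \<open>indep_var\<close> demands.\<close>

lemma indep_var_past_present:
  assumes "indep_vars (\<lambda>_. K) Z (UNIV :: nat set)"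
  shows "indep_var (PiM {..<j} (\<lambda>_. K)) (\<lambda>\<omega>. restrict (\<lambda>i. Z i \<omega>) {..<j})
    (PiM {j} (\<lambda>_. K)) (\<lambda>\<omega>. restrict (\<lambda>i. Z i \<omega>) {j})"
  by (rule indep_var_restrict[OF assms]) auto

lemma past_present_nn_integral:
  assumes ind: "indep_vars (\<lambda>_. K) Z (UNIV :: nat set)"
    and [measurable]: "G \<in> measurable (PiM {..<j} (\<lambda>_. K)) N" "h \<in> borel_measurable (N \<Otimes>\<^sub>M K)"
    and A: "\<And>\<omega>. A \<omega> = G (restrict (\<lambda>i. Z i \<omega>) {..<j})"
  shows "(\<integral>\<^sup>+\<omega>. h (A \<omega>, Z j \<omega>) \<partial>M) = (\<integral>\<^sup>+\<omega>. \<integral>\<^sup>+\<omega>'. h (A \<omega>, Z j \<omega>') \<partial>M \<partial>M)"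
proof -
  have [measurable]: "(\<lambda>z. z j) \<in> measurable (PiM {j} (\<lambda>_. K)) K"
    by (rule measurable_component_singleton) simp
  show ?thesis
    using indep_var_nn_integral_iterated[OF indep_var_past_present[OF ind, of j], of "\<lambda>(z, z'). h (G z, z' j)"]
    by (simp add: A)
qed

lemma past_present_integral:
  fixes h :: "'s \<times> 'z \<Rightarrow> real"
  assumes ind: "indep_vars (\<lambda>_. K) Z (UNIV :: nat set)"
    and [measurable]: "G \<in> measurable (PiM {..<j} (\<lambda>_. K)) N" "h \<in> borel_measurable (N \<Otimes>\<^sub>M K)"
    and A: "\<And>\<omega>. A \<omega> = G (restrict (\<lambda>i. Z i \<omega>) {..<j})"
    and int: "integrable M (\<lambda>\<omega>. h (A \<omega>, Z j \<omega>))"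
  shows "(\<integral>\<omega>. h (A \<omega>, Z j \<omega>) \<partial>M) = (\<integral>\<omega>. \<integral>\<omega>'. h (A \<omega>, Z j \<omega>') \<partial>M \<partial>M)"
proof -
  have [measurable]: "(\<lambda>z. z j) \<in> measurable (PiM {j} (\<lambda>_. K)) K"
    by (rule measurable_component_singleton) simp
  show ?thesis
    using indep_var_integral_iterated[OF indep_var_past_present[OF ind, of j], of "\<lambda>(z, z'). h (G z, z' j)"] int
    by (simp add: A)
qed

end

section \<open>State recursions adapted to their inputs, and a strong law for their
  increments\<close>

primrec drive :: "('s \<Rightarrow> 'z \<Rightarrow> 's) \<Rightarrow> 's \<Rightarrow> (nat \<Rightarrow> 'z) \<Rightarrow> nat \<Rightarrow> 's" where
  "drive f s z 0 = s"
| "drive f s z (Suc n) = f (drive f s z n) (z n)"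

text \<open>Adaptedness: with \<open>n = j\<close>, the state before input \<open>j\<close> is a
  function of the earlier inputs alone, hence independent of \<open>Z j\<close>.\<close>

lemma drive_restrict: "n \<le> j \<Longrightarrow> drive f s (restrict z {..<j}) n = drive f s z n"
  by (induction n) auto

lemma measurable_drive:
  assumes [measurable]: "case_prod f \<in> measurable (N \<Otimes>\<^sub>M K) N" and s: "s \<in> space N" and "n \<le> j"
  shows "(\<lambda>z. drive f s z n) \<in> measurable (PiM {..<j} (\<lambda>_. K)) N"
  using \<open>n \<le> j\<close>
proof (induction n)
  case (Suc n)
  have [measurable]: "(\<lambda>z. drive f s z n) \<in> measurable (PiM {..<j} (\<lambda>_. K)) N"
    using Suc by simp
  have [measurable]: "(\<lambda>z. z n) \<in> measurable (PiM {..<j} (\<lambda>_. K)) K"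
    using Suc.prems by (intro measurable_component_singleton) simp
  have "(\<lambda>z. case_prod f (drive f s z n, z n)) \<in> measurable (PiM {..<j} (\<lambda>_. K)) N"
    by measurable
  then show ?case
    by simp
qed (simp add: s)

lemma (in prob_space) nn_integral_drive:
  assumes "indep_vars (\<lambda>_. K) Z UNIV" "case_prod f \<in> measurable (N \<Otimes>\<^sub>M K) N" "s \<in> space N"
    and "h \<in> borel_measurable (N \<Otimes>\<^sub>M K)"
    and "\<And>\<omega>. S \<omega> = drive f s (\<lambda>i. Z i \<omega>) j"
  shows "(\<integral>\<^sup>+\<omega>. h (S \<omega>, Z j \<omega>) \<partial>M) = (\<integral>\<^sup>+\<omega>. \<integral>\<^sup>+\<omega>'. h (S \<omega>, Z j \<omega>') \<partial>M \<partial>M)"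
  by (rule past_present_nn_integral[OF assms(1) measurable_drive[OF assms(2,3) order_refl] assms(4)])
     (simp add: drive_restrict assms(5))

lemma measurable_drive_compose:
  assumes "\<And>i. Z i \<in> measurable M K" "case_prod f \<in> measurable (N \<Otimes>\<^sub>M K) N" "s \<in> space N"
  shows "(\<lambda>\<omega>. drive f s (\<lambda>i. Z i \<omega>) j) \<in> measurable M N"
proof -
  have "(\<lambda>\<omega>. restrict (\<lambda>i. Z i \<omega>) {..<j}) \<in> measurable M (PiM {..<j} (\<lambda>_. K))"
    by (intro measurable_restrict assms)
  from measurable_compose[OF this measurable_drive[OF assms(2,3) order_refl]]
  show ?thesis
    by (simp add: drive_restrict)
qed

text \<open>For \<open>i < j\<close> the earlier increment and the state \<open>S j\<close> together
  are a function of the inputs before \<open>j\<close>. Freezing both and integrating over input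
  \<open>j\<close> leaves the earlier increment times a zero mean.\<close>

lemma (in prob_space) drive_martingale_difference_orthogonal:
  fixes h :: "'s \<times> 'z \<Rightarrow> real"
  assumes ind: "indep_vars (\<lambda>_. K) Z UNIV"
    and f[measurable]: "case_prod f \<in> measurable (N \<Otimes>\<^sub>M K) N" and s: "s \<in> space N"
    and S: "\<And>n \<omega>. S n \<omega> = drive f s (\<lambda>i. Z i \<omega>) n"
    and h[measurable]: "h \<in> borel_measurable (N \<Otimes>\<^sub>M K)"
    and zero: "\<And>\<omega>. \<omega> \<in> space M \<Longrightarrow> (\<integral>\<omega>'. h (S j \<omega>, Z j \<omega>') \<partial>M) = 0"
    and int: "integrable M (\<lambda>\<omega>. h (S i \<omega>, Z i \<omega>) * h (S j \<omega>, Z j \<omega>))"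
    and "i < j"
  shows "(\<integral>\<omega>. h (S i \<omega>, Z i \<omega>) * h (S j \<omega>, Z j \<omega>) \<partial>M) = 0"
proof -
  let ?P = "PiM {..<j} (\<lambda>_. K)"
  have [measurable]: "(\<lambda>z. drive f s z i) \<in> measurable ?P N" "(\<lambda>z. drive f s z j) \<in> measurable ?P N"
    "(\<lambda>z. z i) \<in> measurable ?P K"
    using \<open>i < j\<close> by (auto intro!: measurable_drive[OF f s])
  let ?h = "\<lambda>p. fst (fst p) * h (snd (fst p), snd p)" and ?A = "\<lambda>\<omega>. (h (S i \<omega>, Z i \<omega>), S j \<omega>)"
  have G: "(\<lambda>z. (h (drive f s z i, z i), drive f s z j)) \<in> measurable ?P (borel \<Otimes>\<^sub>M N)"
    by measurable
  have "(\<integral>\<omega>. ?h (?A \<omega>, Z j \<omega>) \<partial>M) = (\<integral>\<omega>. \<integral>\<omega>'. ?h (?A \<omega>, Z j \<omega>') \<partial>M \<partial>M)"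
    by (rule past_present_integral[OF ind G]) (use \<open>i < j\<close> int in \<open>simp_all add: drive_restrict S\<close>)
  then have "(\<integral>\<omega>. h (S i \<omega>, Z i \<omega>) * h (S j \<omega>, Z j \<omega>) \<partial>M) =
      (\<integral>\<omega>. \<integral>\<omega>'. h (S i \<omega>, Z i \<omega>) * h (S j \<omega>, Z j \<omega>') \<partial>M \<partial>M)"
    by simp
  also have "\<dots> = 0"
    by (simp add: zero cong: Bochner_Integration.integral_cong)
  finally show ?thesis .
qed

lemma square_integrable_of_nn_integral:
  fixes f :: "'a \<Rightarrow> real"
  assumes [measurable]: "f \<in> borel_measurable M" and "0 \<le> C"
    and le: "(\<integral>\<^sup>+\<omega>. ennreal ((f \<omega>)\<^sup>2) \<partial>M) \<le> ennreal C"
  shows "integrable M (\<lambda>\<omega>. (f \<omega>)\<^sup>2)" "(\<integral>\<omega>. (f \<omega>)\<^sup>2 \<partial>M) \<le> C"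
proof -
  show int: "integrable M (\<lambda>\<omega>. (f \<omega>)\<^sup>2)"
    using le by (intro integrableI_bounded) (auto simp: le_less_trans)
  show "(\<integral>\<omega>. (f \<omega>)\<^sup>2 \<partial>M) \<le> C"
    using le \<open>0 \<le> C\<close> by (simp add: nn_integral_eq_integral[OF int])
qed

lemma (in prob_space) drive_strong_law:
  fixes h :: "'s \<times> 'z \<Rightarrow> real"
  assumes ind: "indep_vars (\<lambda>_. K) Z UNIV"
    and f: "case_prod f \<in> measurable (N \<Otimes>\<^sub>M K) N" and s: "s \<in> space N"
    and S: "\<And>n \<omega>. S n \<omega> = drive f s (\<lambda>i. Z i \<omega>) n"
    and h[measurable]: "h \<in> borel_measurable (N \<Otimes>\<^sub>M K)"
    and zero: "\<And>j \<omega>. \<omega> \<in> space M \<Longrightarrow> (\<integral>\<omega>'. h (S j \<omega>, Z j \<omega>') \<partial>M) = 0"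
    and le: "\<And>j. (\<integral>\<^sup>+\<omega>. ennreal ((h (S j \<omega>, Z j \<omega>))\<^sup>2) \<partial>M) \<le> ennreal C" and C: "0 \<le> C"
  shows "AE \<omega> in M. (\<lambda>n. (\<Sum>j<n. h (S j \<omega>, Z j \<omega>)) / real n) \<longlonglongrightarrow> 0"
proof -
  have [measurable]: "Z j \<in> measurable M K" for j
    using ind by (auto simp: indep_vars_def)
  have [measurable]: "S j \<in> measurable M N" for j
    unfolding S by (rule measurable_drive_compose[OF _ f s]) simp
  have meas: "(\<lambda>\<omega>. h (S j \<omega>, Z j \<omega>)) \<in> borel_measurable M" for j
    by measurable
  note sq = square_integrable_of_nn_integral[OF meas C le]
  show ?thesis
  proof (rule strong_law_orthogonal[OF meas sq])
    fix i j :: nat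
    assume "i < j"
    then show "(\<integral>\<omega>. h (S i \<omega>, Z i \<omega>) * h (S j \<omega>, Z j \<omega>) \<partial>M) = 0"
      by (intro drive_martingale_difference_orthogonal[OF ind f s S h zero]
          integrable_mult_of_squares meas sq)
  qed
qed

text \<open>Shifting the variable by \<open>r\<close> pulls the factor \<open>exp (- l * r)\<close>
  out of the density. No integrability of \<open>g\<close> is asked for, since each step is valid
  for the Bochner integral with its default value 0.\<close>

lemma (in prob_space) exponential_memoryless_integral:
  fixes g :: "real \<Rightarrow> real"
  assumes D: "distributed M lborel A (exponential_density l)" and l: "0 < l" and r: "0 \<le> r"
    and [measurable]: "g \<in> borel_measurable borel"
  shows "(\<integral>\<omega>. (if r \<le> A \<omega> then g (A \<omega> - r) else 0) \<partial>M) = exp (- l * r) * (\<integral>\<omega>. g (A \<omega>) \<partial>M)"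
proof -
  have nonneg: "0 \<le> exponential_density l a" for a
    using l by simp
  have "(\<integral>\<omega>. (if r \<le> A \<omega> then g (A \<omega> - r) else 0) \<partial>M) =
      (\<integral>a. exponential_density l a * (if r \<le> a then g (a - r) else 0) \<partial>lborel)"
    using nonneg by (intro distributed_integral[OF D, symmetric]) auto
  also have "\<dots> = (\<integral>a. exponential_density l (r + 1 * a) * (if r \<le> r + 1 * a then g (r + 1 * a - r) else 0) \<partial>lborel)"
    by (subst lborel_integral_real_affine[of 1 _ r]) simp_all
  also have "\<dots> = (\<integral>a. exp (- l * r) * (exponential_density l a * g a) \<partial>lborel)"
    using r
    by (intro Bochner_Integration.integral_cong)
       (auto simp: exponential_density_def algebra_simps simp flip: exp_add)
  also have "\<dots> = exp (- l * r) * (\<integral>\<omega>. g (A \<omega>) \<partial>M)"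
    using nonneg by (simp add: distributed_integral[OF D])
  finally show ?thesis .
qed

section \<open>Sample paths\<close>

text \<open>A state \<open>(r, x)\<close> consists of the residual service time \<open>r\<close> just after an arrival and the age \<open>x\<close> at
  the epoch when that service ends; an input \<open>(a, i)\<close> consists of the next interarrival time and
  realization index.\<close>

definition starts :: "nat \<Rightarrow> real \<times> real \<Rightarrow> real \<times> nat \<Rightarrow> bool" where
  "starts k s z \<longleftrightarrow> 1 \<le> snd z \<and> snd z \<le> k \<and> fst s \<le> fst z"

definition idle :: "real \<times> real \<Rightarrow> real \<times> nat \<Rightarrow> real" where
  "idle s z = max 0 (fst z - fst s)"

definition gap :: "nat \<Rightarrow> (nat \<Rightarrow> nat) \<Rightarrow> real \<times> real \<Rightarrow> real \<times> nat \<Rightarrow> real" where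
  "gap k len s z = idle s z + (if starts k s z then real (len (snd z)) else 0)"

text \<open>A served packet is delivered exactly one codeword length after its generation, so its
  residual service time and the age at its delivery are the same number.\<close>

definition step :: "nat \<Rightarrow> (nat \<Rightarrow> nat) \<Rightarrow> real \<times> real \<Rightarrow> real \<times> nat \<Rightarrow> real \<times> real" where
  "step k len s z =
     (if starts k s z then (real (len (snd z)), real (len (snd z)))
      else (max 0 (fst s - fst z), snd s + idle s z))"

definition area :: "nat \<Rightarrow> (nat \<Rightarrow> nat) \<Rightarrow> real \<times> real \<Rightarrow> real \<times> nat \<Rightarrow> real" where
  "area k len s z = snd s * gap k len s z + (gap k len s z)\<^sup>2 / 2"

lemma idle_nonneg: "idle s z \<ge> 0"
  by (simp add: idle_def)

lemma gap_nonneg: "gap k len s z \<ge> 0"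
  by (simp add: gap_def idle_nonneg)

locale sample_path =
  fixes k :: nat and len :: "nat \<Rightarrow> nat" and IA :: "nat \<Rightarrow> real" and Xr :: "nat \<Rightarrow> nat"
  assumes IA_nonneg: "\<And>j. IA j \<ge> 0"
begin

definition st :: "nat \<Rightarrow> real \<times> real" where
  "st = drive (step k len) (0, 0) (\<lambda>j. (IA j, Xr j))"

text \<open>The sum is the time of the last arrival seen. If that arrival leaves the transmitter
  idle, the epoch is the arrival time itself, so an epoch need not be a delivery.\<close>

definition epoch :: "nat \<Rightarrow> real" where
  "epoch j = (\<Sum>i<j. IA i) + fst (st j)"

abbreviation "\<delta> j \<equiv> gap k len (st j) (IA j, Xr j)"

lemma st_0: "st 0 = (0, 0)" and st_Suc: "st (Suc j) = step k len (st j) (IA j, Xr j)"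
  by (simp_all add: st_def)

lemma st_nonneg: "fst (st j) \<ge> 0" "snd (st j) \<ge> 0"
  by (induction j) (auto simp: st_0 st_Suc step_def idle_def)

lemma arrival_eq: "arrival IA j = (\<Sum>i<j. IA i) + IA j"
  by (simp add: arrival_def flip: lessThan_Suc_atMost)

lemma epoch_0: "epoch 0 = 0"
  by (simp add: epoch_def st_0)

lemma epoch_Suc: "epoch (Suc j) = epoch j + \<delta> j"
  by (auto simp: epoch_def st_Suc step_def gap_def idle_def starts_def)

lemma mono_epoch: "mono epoch"
  by (simp add: mono_iff_le_Suc epoch_Suc gap_nonneg)

lemma epoch_nonneg: "epoch j \<ge> 0"
  using monoD[OF mono_epoch, of 0 j] by (simp add: epoch_0)

text \<open>Ties the Markov state to the recursion of the model. The truncation at 0 is needed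
  because \<open>busy_until\<close> keeps an old completion time while the transmitter idles. For
  \<open>IA j \<ge> 0\<close> the truncation does not affect the test for being served.\<close>

lemma residual_eq: "fst (st j) = max 0 (busy_until k len IA Xr j - (\<Sum>i<j. IA i))"
proof (induction j)
  case (Suc j)
  have "starts k (st j) (IA j, Xr j) \<longleftrightarrow>
      1 \<le> Xr j \<and> Xr j \<le> k \<and> busy_until k len IA Xr j \<le> arrival IA j"
    using Suc IA_nonneg[of j] by (auto simp: starts_def arrival_eq)
  then show ?case
    using Suc IA_nonneg[of j] by (auto simp: st_Suc step_def arrival_eq)
qed (simp add: st_0)

lemma served_iff: "served k len IA Xr j \<longleftrightarrow> starts k (st j) (IA j, Xr j)"
  using residual_eq[of j] IA_nonneg[of j] by (auto simp: served_def starts_def arrival_eq)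

lemma delivery_eq: "served k len IA Xr j \<Longrightarrow> arrival IA j + real (len (Xr j)) = epoch (Suc j)"
  by (simp add: served_iff epoch_def st_Suc step_def arrival_eq)

lemma mono_arrival: "i \<le> j \<Longrightarrow> arrival IA i \<le> arrival IA j"
  unfolding arrival_def by (intro sum_mono2) (auto simp: IA_nonneg)

text \<open>Epoch minus age is the generation time of the newest served packet, or the default 0
  before any service. It is phrased as an upper bound that is attained, the form in which a maximum
  is identified.\<close>

lemma age_origin:
  "(\<forall>i<j. served k len IA Xr i \<longrightarrow> arrival IA i \<le> epoch j - snd (st j)) \<and>
   (if \<exists>i<j. served k len IA Xr i
    then \<exists>i<j. served k len IA Xr i \<and> epoch j - snd (st j) = arrival IA i
    else epoch j - snd (st j) = 0)"
proof (induction j)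
  case 0
  then show ?case by (simp add: epoch_0 st_0)
next
  case (Suc j)
  show ?case
  proof (cases "served k len IA Xr j")
    case True
    then have "epoch (Suc j) - snd (st (Suc j)) = arrival IA j"
      by (simp add: served_iff epoch_def st_Suc step_def arrival_eq)
    then show ?thesis
      using True mono_arrival by (auto intro: exI[of _ j])
  next
    case False
    then have "epoch (Suc j) - snd (st (Suc j)) = epoch j - snd (st j)"
      by (simp add: served_iff epoch_Suc st_Suc step_def gap_def)
    moreover have
      ex: "(\<exists>i<Suc j. served k len IA Xr i \<and> Q i) \<longleftrightarrow> (\<exists>i<j. served k len IA Xr i \<and> Q i)" and
      ex': "(\<exists>i<Suc j. served k len IA Xr i) \<longleftrightarrow> (\<exists>i<j. served k len IA Xr i)" and
      all: "(\<forall>i<Suc j. served k len IA Xr i \<longrightarrow> Q i) \<longleftrightarrow> (\<forall>i<j. served k len IA Xr i \<longrightarrow> Q i)" for Q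
      using False by (auto simp: less_Suc_eq)
    ultimately show ?thesis
      using Suc False by (simp only: ex ex' all)
  qed
qed

lemma age_eq:
  assumes "epoch j \<le> t" "t < epoch (Suc j)"
  shows "age k len IA Xr t = t - epoch j + snd (st j)"
proof -
  \<comment> \<open>Served packet \<open>i\<close> is delivered at \<open>epoch (Suc i)\<close>, and
    epochs are monotone, so the updates received by time \<open>t\<close> are exactly the served
    ones among the first \<open>j\<close>.\<close>
  have delivered: "arrival IA i + real (len (Xr i)) \<le> t \<longleftrightarrow> i < j" if "served k len IA Xr i" for i
  proof
    assume "arrival IA i + real (len (Xr i)) \<le> t"
    then have "epoch (Suc i) < epoch (Suc j)"
      using assms delivery_eq[OF that] by simp
    then have "Suc i < Suc j"
      using monoD[OF mono_epoch, of "Suc j" "Suc i"] by linarith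
    then show "i < j" by simp
  next
    assume "i < j"
    then have "epoch (Suc i) \<le> epoch j"
      by (intro monoD[OF mono_epoch]) simp
    then show "arrival IA i + real (len (Xr i)) \<le> t"
      using assms delivery_eq[OF that] by simp
  qed
  define R where "R = {arrival IA i | i. served k len IA Xr i \<and> arrival IA i + real (len (Xr i)) \<le> t}"
  have R: "R = arrival IA ` {i. i < j \<and> served k len IA Xr i}"
    unfolding R_def using delivered by auto
  have fin: "finite R"
    unfolding R by simp
  have "last_gen k len IA Xr t = epoch j - snd (st j)"
  proof (cases "\<exists>i<j. served k len IA Xr i")
    case True
    then have "Max R = epoch j - snd (st j)"
      using age_origin[of j] by (intro Max_eqI fin) (auto simp: R)
    moreover have "R \<noteq> {}"
      using True by (auto simp: R)
    ultimately show ?thesis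
      unfolding last_gen_def Let_def R_def[symmetric] by simp
  next
    case False
    then have "R = {}"
      by (auto simp: R)
    then show ?thesis
      using False age_origin[of j] unfolding last_gen_def Let_def R_def[symmetric] by simp
  qed
  then show ?thesis
    by (simp add: age_def)
qed

lemma age_has_integral_gap:
  "(age k len IA Xr has_integral area k len (st j) (IA j, Xr j)) {epoch j..epoch (Suc j)}"
proof -
  define G where "G t = (t - epoch j)\<^sup>2 / 2 + snd (st j) * t" for t
  have "((\<lambda>t. t - epoch j + snd (st j)) has_integral (G (epoch (Suc j)) - G (epoch j))) {epoch j..epoch (Suc j)}"
  proof (rule fundamental_theorem_of_calculus)
    show "epoch j \<le> epoch (Suc j)"
      by (simp add: epoch_Suc gap_nonneg)
    show "(G has_vector_derivative t - epoch j + snd (st j)) (at t within {epoch j..epoch (Suc j)})" for t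
      unfolding G_def has_real_derivative_iff_has_vector_derivative[symmetric]
      by (auto intro!: derivative_eq_intros)
  qed
  moreover have "G (epoch (Suc j)) - G (epoch j) = area k len (st j) (IA j, Xr j)"
    by (simp add: G_def epoch_Suc area_def algebra_simps)
  ultimately have "((\<lambda>t. t - epoch j + snd (st j)) has_integral area k len (st j) (IA j, Xr j))
      {epoch j..epoch (Suc j)}"
    by simp
  then show ?thesis
    \<comment> \<open>At the right endpoint a delivery may already have made the age jump; a single
      point does not change the integral.\<close>
    by (rule has_integral_spike_finite[of "{epoch (Suc j)}", rotated 2]) (auto simp: age_eq)
qed

lemma age_has_integral:
  "(age k len IA Xr has_integral (\<Sum>j<N. area k len (st j) (IA j, Xr j))) {0..epoch N}"
proof (induction N)
  case 0
  then show ?case by (simp add: epoch_0 has_integral_refl)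
next
  case (Suc N)
  show ?case
    using has_integral_combine[OF epoch_nonneg _ Suc age_has_integral_gap]
    by (simp add: epoch_Suc gap_nonneg)
qed

lemma epoch_bracket:
  assumes "filterlim epoch at_top sequentially" "0 \<le> t"
  obtains j where "epoch j \<le> t" "t < epoch (Suc j)"
proof -
  obtain n where n: "t < epoch n"
    using assms(1) by (metis filterlim_at_top_dense eventually_sequentially order_refl)
  define j where "j = (LEAST n. t < epoch n)"
  have "t < epoch j"
    unfolding j_def using n by (rule LeastI)
  moreover from this obtain i where i: "j = Suc i"
    using assms(2) epoch_0 by (cases j) auto
  moreover have "\<not> t < epoch i"
    using not_less_Least[of i "\<lambda>n. t < epoch n"] i j_def by simp
  ultimately show ?thesis
    using that[of i] by simp
qed

end

text \<open>By monotonicity \<open>F t / t\<close> lies between \<open>F (e N) / e (Suc N)\<close>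
  and \<open>F (e (Suc N)) / e N\<close> for the \<open>N\<close> bracketing \<open>t\<close>. Both
  quotients tend to \<open>d\<close>, because consecutive values of \<open>e\<close> have ratio
  tending to 1.\<close>

lemma tendsto_average_at_top_from_sequence:
  fixes F :: "real \<Rightarrow> real" and e :: "nat \<Rightarrow> real"
  assumes mono: "\<And>s t. 0 \<le> s \<Longrightarrow> s \<le> t \<Longrightarrow> F s \<le> F t" and F0: "F 0 \<ge> 0"
    and e: "mono e" "e 0 = 0"
    and e_lim: "(\<lambda>N. e N / real N) \<longlonglongrightarrow> c" and c: "c > 0"
    and F_lim: "(\<lambda>N. F (e N) / real N) \<longlonglongrightarrow> d * c"
    and bracket: "\<And>t. 0 \<le> t \<Longrightarrow> \<exists>j. e j \<le> t \<and> t < e (Suc j)"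
  shows "((\<lambda>t. F t / t) \<longlongrightarrow> d) at_top"
proof -
  have e_lim': "(\<lambda>N. e (Suc N) / real (Suc N)) \<longlonglongrightarrow> c"
    and F_lim': "(\<lambda>N. F (e (Suc N)) / real (Suc N)) \<longlonglongrightarrow> d * c"
    using LIMSEQ_Suc[OF e_lim] LIMSEQ_Suc[OF F_lim] .
  have Suc_lim: "(\<lambda>N. real (Suc N) / real N) \<longlonglongrightarrow> 1"
    by (rule LIMSEQ_Suc_n_over_n)
  have Suc_lim': "(\<lambda>N. real N / real (Suc N)) \<longlonglongrightarrow> 1"
    by (rule LIMSEQ_n_over_Suc_n)
  have ev: "eventually (\<lambda>N. N > 0) sequentially"
    by (rule eventually_gt_at_top)
  \<comment> \<open>\<open>b = 0\<close> is allowed because early values of \<open>e\<close> may be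
    zero; both sides are then 0.\<close>
  have cancel: "a / u / (b / v) * (u / v) = a / b" if "u \<noteq> 0" "v \<noteq> 0" for a b u v :: real
    using that by (cases "b = 0") (auto simp: field_simps)
  have "(\<lambda>N. F (e N) / real N / (e (Suc N) / real (Suc N)) * (real N / real (Suc N))) \<longlonglongrightarrow> d * c / c * 1"
    using c by (intro tendsto_mult tendsto_divide F_lim e_lim' Suc_lim') auto
  then have lo: "(\<lambda>N. F (e N) / e (Suc N)) \<longlonglongrightarrow> d"
    using c by (rule_tac Lim_transform_eventually) (auto intro!: eventually_mono[OF ev] simp: cancel simp del: of_nat_Suc)
  have "(\<lambda>N. F (e (Suc N)) / real (Suc N) / (e N / real N) * (real (Suc N) / real N)) \<longlonglongrightarrow> d * c / c * 1"
    using c by (intro tendsto_mult tendsto_divide F_lim' e_lim Suc_lim) auto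
  then have hi: "(\<lambda>N. F (e (Suc N)) / e N) \<longlonglongrightarrow> d"
    using c by (rule_tac Lim_transform_eventually) (auto intro!: eventually_mono[OF ev] simp: cancel simp del: of_nat_Suc)
  obtain \<nu> where \<nu>: "\<And>t. 0 \<le> t \<Longrightarrow> e (\<nu> t) \<le> t \<and> t < e (Suc (\<nu> t))"
    using bracket by metis
  have \<nu>_lim: "filterlim \<nu> at_top at_top"
    unfolding filterlim_at_top
  proof
    fix m
    show "eventually (\<lambda>t. m \<le> \<nu> t) at_top"
      using eventually_ge_at_top[of "max 0 (e m)"]
    proof eventually_elim
      case (elim t)
      then have "e m < e (Suc (\<nu> t))"
        using \<nu>[of t] by auto
      then show ?case
        using monoD[OF e(1), of "Suc (\<nu> t)" m] by (meson not_less not_less_eq_eq)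
    qed
  qed
  have "eventually (\<lambda>N. e N / real N > 0) sequentially"
    using order_tendstoD(1)[OF e_lim c] .
  then have "eventually (\<lambda>t. e (\<nu> t) / real (\<nu> t) > 0) at_top"
    using \<nu>_lim by (rule eventually_compose_filterlim)
  then have bounds: "eventually (\<lambda>t. 0 < e (\<nu> t) \<and> e (\<nu> t) \<le> t \<and> t < e (Suc (\<nu> t))) at_top"
    using eventually_ge_at_top[of 0]
  proof eventually_elim
    case (elim t)
    then show ?case
      using \<nu>[of t] by (auto simp: zero_less_divide_iff)
  qed
  show ?thesis
  proof (rule tendsto_sandwich)
    show "((\<lambda>t. F (e (\<nu> t)) / e (Suc (\<nu> t))) \<longlongrightarrow> d) at_top"
      by (rule filterlim_compose[OF lo \<nu>_lim])
    show "((\<lambda>t. F (e (Suc (\<nu> t))) / e (\<nu> t)) \<longlongrightarrow> d) at_top"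
      by (rule filterlim_compose[OF hi \<nu>_lim])
    show "\<forall>\<^sub>F t in at_top. F (e (\<nu> t)) / e (Suc (\<nu> t)) \<le> F t / t"
      using bounds
    proof eventually_elim
      case (elim t)
      then have "F 0 \<le> F (e (\<nu> t))" "F (e (\<nu> t)) \<le> F t"
        by (auto intro!: mono)
      with elim F0 show ?case
        by (intro frac_le) auto
    qed
    show "\<forall>\<^sub>F t in at_top. F t / t \<le> F (e (Suc (\<nu> t))) / e (\<nu> t)"
      using bounds
    proof eventually_elim
      case (elim t)
      then have "F 0 \<le> F t" "F t \<le> F (e (Suc (\<nu> t)))"
        by (auto intro!: mono)
      with elim F0 show ?case
        by (intro frac_le) auto
    qed
  qed
qed

context sample_path
begin

lemma average_age_tendsto:
  assumes e_lim: "(\<lambda>N. epoch N / real N) \<longlonglongrightarrow> c" and c: "c > 0"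
    and area_lim: "(\<lambda>N. ((\<Sum>j<N. area k len (st j) (IA j, Xr j)) - d * epoch N) / real N) \<longlonglongrightarrow> 0"
  shows "((\<lambda>T. integral {0..T} (age k len IA Xr) / T) \<longlongrightarrow> d) at_top"
proof -
  have "filterlim (\<lambda>N. epoch N / real N * real N) at_top sequentially"
    by (rule filterlim_tendsto_pos_mult_at_top[OF e_lim c filterlim_real_sequentially])
  then have top: "filterlim epoch at_top sequentially"
    by (rule filterlim_mono_eventually) (auto intro!: eventually_mono[OF eventually_gt_at_top[of 0]] simp: epoch_0)
  note bracket = epoch_bracket[OF top]
  have nonneg: "age k len IA Xr t \<ge> 0" if "t \<ge> 0" for t
    using bracket[OF that] age_eq st_nonneg by (metis add_nonneg_nonneg diff_ge_0_iff_ge)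
  have integrable: "age k len IA Xr integrable_on {0..t}" if t: "t \<ge> 0" for t
  proof -
    obtain j where "t < epoch (Suc j)"
      using bracket[OF t] by metis
    then show ?thesis
      using has_integral_integrable[OF age_has_integral[of "Suc j"]]
      by (rule_tac integrable_on_subinterval) auto
  qed
  show ?thesis
  proof (rule tendsto_average_at_top_from_sequence[OF _ _ mono_epoch epoch_0 e_lim c])
    fix s t :: real
    assume st: "0 \<le> s" "s \<le> t"
    then show "integral {0..s} (age k len IA Xr) \<le> integral {0..t} (age k len IA Xr)"
      by (intro integral_subset_le integrable) (auto intro: nonneg)
  next
    have "(\<lambda>N. ((\<Sum>j<N. area k len (st j) (IA j, Xr j)) - d * epoch N) / real N + d * (epoch N / real N))
        \<longlonglongrightarrow> 0 + d * c"
      by (intro tendsto_intros area_lim e_lim)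
    then show "(\<lambda>N. integral {0..epoch N} (age k len IA Xr) / real N) \<longlonglongrightarrow> d * c"
      by (simp add: integral_unique[OF age_has_integral] diff_divide_distrib)
  next
    fix t :: real
    assume "0 \<le> t"
    then show "\<exists>j. epoch j \<le> t \<and> t < epoch (Suc j)"
      using bracket by metis
  qed simp
qed

end

section \<open>The compensated area\<close>

locale status_update = prob_space M for M :: "'a measure" +
  fixes IA :: "nat \<Rightarrow> 'a \<Rightarrow> real" and X :: "nat \<Rightarrow> 'a \<Rightarrow> nat" and P :: "nat \<Rightarrow> real"
    and len :: "nat \<Rightarrow> nat" and k :: nat and lam :: real
  assumes lam_pos: "lam > 0"
    and q_pos: "(\<Sum>i=1..k. P i) > 0"
    and IA_exp: "\<And>j. distributed M lborel (IA j) (exponential_density lam)"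
    and X_rv: "\<And>j. X j \<in> measurable M (count_space UNIV)"
    and X_dist: "\<And>j i. 1 \<le> i \<Longrightarrow> i \<le> k \<Longrightarrow> prob {\<omega> \<in> space M. X j \<omega> = i} = P i"
    and indep: "indep_vars (\<lambda>_. borel)
        (\<lambda>c. case c of Inl j \<Rightarrow> IA j | Inr j \<Rightarrow> (\<lambda>\<omega>. real (X j \<omega>))) UNIV"
begin

definition "q = (\<Sum>i=1..k. P i)"
definition "EL = (\<Sum>i=1..k. P i / q * real (len i))"
definition "EL2 = (\<Sum>i=1..k. P i / q * (real (len i))\<^sup>2)"

definition Z :: "nat \<Rightarrow> 'a \<Rightarrow> real \<times> nat" where
  "Z j \<omega> = (IA j \<omega>, X j \<omega>)"

abbreviation "K \<equiv> borel \<Otimes>\<^sub>M count_space (UNIV :: nat set)"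

lemma measurable_IA[measurable]: "IA j \<in> borel_measurable M"
  using distributed_measurable[OF IA_exp[of j]] by simp

lemma measurable_X[measurable]: "X j \<in> measurable M (count_space UNIV)"
  by (rule X_rv)

lemma AE_IA_nonneg: "AE \<omega> in M. \<forall>j. 0 \<le> IA j \<omega>"
  unfolding AE_all_countable
proof
  show "AE \<omega> in M. 0 \<le> IA j \<omega>" for j
    by (subst distributed_AE2[OF IA_exp[of j]]) (auto simp: erlang_density_def)
qed

text \<open>The hypothesis concerns one family of reals indexed by a sum type. Its coordinates
  \<open>Inl j\<close> and \<open>Inr j\<close> are grouped into blocks, and \<open>nat\<close> of
  the floor recovers the realization index from its real image.\<close>

lemma indep_Z: "indep_vars (\<lambda>_. K) Z UNIV"
proof -
  let ?W = "\<lambda>c. case c of Inl j \<Rightarrow> IA j | Inr j \<Rightarrow> (\<lambda>\<omega>. real (X j \<omega>))"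
  have "indep_vars (\<lambda>j. PiM {Inl j, Inr j} (\<lambda>_. borel))
      (\<lambda>j \<omega>. restrict (\<lambda>c. ?W c \<omega>) {Inl j, Inr j}) UNIV"
    by (rule indep_vars_restrict[OF indep]) (auto simp: disjoint_family_on_def)
  then have "indep_vars (\<lambda>_. K)
      (\<lambda>j \<omega>. (\<lambda>w. (w (Inl j), nat \<lfloor>w (Inr j)\<rfloor>)) (restrict (\<lambda>c. ?W c \<omega>) {Inl j, Inr j})) UNIV"
  proof (rule indep_vars_compose2)
    fix j :: nat
    let ?Q = "PiM {Inl j, Inr j} (\<lambda>_. borel :: real measure)"
    have "(\<lambda>w. w (Inl j)) \<in> measurable ?Q borel" "(\<lambda>w. w (Inr j)) \<in> measurable ?Q borel"
      by (auto intro!: measurable_component_singleton)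
    moreover have "(\<lambda>y :: real. nat \<lfloor>y\<rfloor>) \<in> measurable borel (count_space UNIV)"
      by measurable
    ultimately show "(\<lambda>w. (w (Inl j), nat \<lfloor>w (Inr j)\<rfloor>)) \<in> measurable ?Q K"
      by (intro measurable_Pair) (auto intro: measurable_compose)
  qed
  then show ?thesis
    by (simp add: Z_def[abs_def])
qed

lemma indep_IA_X: "indep_var borel (IA j) borel (\<lambda>\<omega>. real (X j \<omega>))"
proof -
  let ?W = "\<lambda>c. case c of Inl j \<Rightarrow> IA j | Inr j \<Rightarrow> (\<lambda>\<omega>. real (X j \<omega>))"
  have "indep_var borel ((\<lambda>w. w (Inl j)) \<circ> (\<lambda>\<omega>. restrict (\<lambda>c. ?W c \<omega>) {Inl j}))
      borel ((\<lambda>w. w (Inr j)) \<circ> (\<lambda>\<omega>. restrict (\<lambda>c. ?W c \<omega>) {Inr j}))"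
    by (rule indep_var_compose[OF indep_var_restrict[OF indep]])
       (auto intro!: measurable_component_singleton)
  then show ?thesis
    by (simp add: comp_def)
qed

section \<open>Moments of a single input\<close>

definition sel :: "(nat \<Rightarrow> real) \<Rightarrow> nat \<Rightarrow> real" where
  "sel c i = (if 1 \<le> i \<and> i \<le> k then c i else 0)"

lemma expectation_sel:
  shows integrable_sel: "integrable M (\<lambda>\<omega>. sel c (X j \<omega>))"
    and "(\<integral>\<omega>. sel c (X j \<omega>) \<partial>M) = (\<Sum>i=1..k. P i * c i)"
proof -
  have eq: "sel c (X j \<omega>) = (\<Sum>i=1..k. indicator {\<omega> \<in> space M. X j \<omega> = i} \<omega> * c i)"
    if "\<omega> \<in> space M" for \<omega>
  proof -
    have "(\<Sum>i=1..k. indicator {\<omega> \<in> space M. X j \<omega> = i} \<omega> * c i) = (\<Sum>i=1..k. if X j \<omega> = i then c i else 0)"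
      using that by (intro sum.cong) auto
    then show ?thesis
      by (simp add: sel_def)
  qed
  have sets: "{\<omega> \<in> space M. X j \<omega> = i} \<in> events" for i
    by measurable
  have "integrable M (\<lambda>\<omega>. \<Sum>i=1..k. indicator {\<omega> \<in> space M. X j \<omega> = i} \<omega> * c i)"
    by (intro Bochner_Integration.integrable_sum integrable_mult_left integrable_real_indicator)
       (auto simp: less_top[symmetric])
  then show "integrable M (\<lambda>\<omega>. sel c (X j \<omega>))"
    by (simp add: eq cong: Bochner_Integration.integrable_cong)
  have "(\<integral>\<omega>. sel c (X j \<omega>) \<partial>M) =
      (\<integral>\<omega>. (\<Sum>i=1..k. indicator {\<omega> \<in> space M. X j \<omega> = i} \<omega> * c i) \<partial>M)"
    by (intro Bochner_Integration.integral_cong refl eq)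
  also have "\<dots> = (\<Sum>i=1..k. \<integral>\<omega>. indicator {\<omega> \<in> space M. X j \<omega> = i} \<omega> * c i \<partial>M)"
    by (intro Bochner_Integration.integral_sum integrable_mult_left integrable_real_indicator)
       (auto simp: less_top[symmetric])
  also have "\<dots> = (\<Sum>i=1..k. P i * c i)"
    using sets by (intro sum.cong) (simp_all add: X_dist)
  finally show "(\<integral>\<omega>. sel c (X j \<omega>) \<partial>M) = (\<Sum>i=1..k. P i * c i)" .
qed

text \<open>Powers of the idle time preceding the arrival, cut off when the arrival finds a service
  in progress. The case \<open>p = 0\<close> is the indicator of \<open>r \<le> a\<close>.\<close>

definition overshoot :: "real \<Rightarrow> nat \<Rightarrow> real \<Rightarrow> real" where
  "overshoot r p a = (if r \<le> a then (a - r) ^ p else 0)"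

lemma measurable_overshoot[measurable]: "overshoot r p \<in> borel_measurable borel"
  unfolding overshoot_def by measurable

lemma expectation_overshoot:
  assumes "0 \<le> r"
  shows integrable_overshoot: "integrable M (\<lambda>\<omega>. overshoot r p (IA j \<omega>))"
    and "(\<integral>\<omega>. overshoot r p (IA j \<omega>) \<partial>M) = exp (- lam * r) * fact p / lam ^ p"
proof -
  show "integrable M (\<lambda>\<omega>. overshoot r p (IA j \<omega>))"
  proof (rule Bochner_Integration.integrable_bound)
    show "integrable M (\<lambda>\<omega>. IA j \<omega> ^ p)"
      by (rule erlang_ith_moment_integrable[OF lam_pos IA_exp])
    show "AE \<omega> in M. norm (overshoot r p (IA j \<omega>)) \<le> norm (IA j \<omega> ^ p)"
      using assms by (auto simp: overshoot_def norm_power intro!: power_mono)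
  qed measurable
  show "(\<integral>\<omega>. overshoot r p (IA j \<omega>) \<partial>M) = exp (- lam * r) * fact p / lam ^ p"
    using exponential_memoryless_integral[OF IA_exp lam_pos assms, of "\<lambda>a. a ^ p" j]
      erlang_ith_moment[OF lam_pos IA_exp, of j p]
    by (simp add: overshoot_def)
qed

lemma expectation_overshoot_sel:
  assumes "0 \<le> r"
  shows "integrable M (\<lambda>\<omega>. overshoot r p (IA j \<omega>) * sel c (X j \<omega>))"
    and "(\<integral>\<omega>. overshoot r p (IA j \<omega>) * sel c (X j \<omega>) \<partial>M) =
      exp (- lam * r) * fact p / lam ^ p * (\<Sum>i=1..k. P i * c i)"
proof -
  have "indep_var borel (overshoot r p \<circ> IA j) borel ((\<lambda>y. sel c (nat \<lfloor>y\<rfloor>)) \<circ> (\<lambda>\<omega>. real (X j \<omega>)))"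
    by (rule indep_var_compose[OF indep_IA_X]) measurable
  then have ind: "indep_var borel (\<lambda>\<omega>. overshoot r p (IA j \<omega>)) borel (\<lambda>\<omega>. sel c (X j \<omega>))"
    by (simp add: comp_def)
  note int = integrable_overshoot[OF assms, of p j] integrable_sel[of c j]
  show "integrable M (\<lambda>\<omega>. overshoot r p (IA j \<omega>) * sel c (X j \<omega>))"
    by (rule indep_var_integrable[OF ind int])
  show "(\<integral>\<omega>. overshoot r p (IA j \<omega>) * sel c (X j \<omega>) \<partial>M) =
      exp (- lam * r) * fact p / lam ^ p * (\<Sum>i=1..k. P i * c i)"
    by (simp add: indep_var_lebesgue_integral[OF ind int] expectation_sel(2) expectation_overshoot(2)[OF assms])
qed

section \<open>The compensated increment and its mean\<close>

definition "m = EL + 1 / (q * lam)"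

text \<open>A cycle is a codeword length plus an independent idle time of rate
  \<open>q * lam\<close>; the numerator is the second moment of its length and \<open>m\<close> the
  first moment.\<close>

definition "\<Delta> = (EL2 + 2 / (q * lam) * EL + 2 / (q * lam) ^ 2) / (2 * m) + EL"

definition compensated :: "(real \<times> real) \<times> (real \<times> nat) \<Rightarrow> real" where
  "compensated p = area k len (fst p) (snd p) - \<Delta> * gap k len (fst p) (snd p)
     + m * (snd (step k len (fst p) (snd p)) - snd (fst p))"

lemma q_pos': "q > 0"
  using q_pos by (simp add: q_def)

lemma sum_P: "(\<Sum>i=1..k. P i * 1) = q" "(\<Sum>i=1..k. P i * real (len i)) = q * EL"
  "(\<Sum>i=1..k. P i * (real (len i))\<^sup>2) = q * EL2"
  using q_pos' by (simp_all only: EL_def EL2_def sum_distrib_left) (auto simp: q_def)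

lemma EL_nonneg: "EL \<ge> 0"
proof -
  have "P i \<ge> 0" if "1 \<le> i" "i \<le> k" for i
    using X_dist[OF that] measure_nonneg by metis
  then show ?thesis
    unfolding EL_def using q_pos' by (intro sum_nonneg mult_nonneg_nonneg divide_nonneg_pos) auto
qed

lemma m_pos: "m > 0"
  unfolding m_def using EL_nonneg q_pos' lam_pos by (intro add_nonneg_pos) auto

text \<open>With \<open>t = 1 / (q * lam)\<close> everything besides \<open>EL2 / 2\<close> is
  \<open>t * EL + t\<^sup>2 + EL * (EL + t)\<close>, the square of \<open>EL + t\<close>.\<close>

lemma \<Delta>_times_m: "\<Delta> * m = EL2 / 2 + m\<^sup>2"
proof -
  have "\<Delta> * m = (EL2 + 2 / (q * lam) * EL + 2 / (q * lam) ^ 2) / 2 + EL * m"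
    using m_pos by (simp add: \<Delta>_def field_simps)
  also have "\<dots> = EL2 / 2 + m\<^sup>2"
  proof -
    define t where "t = 1 / (q * lam)"
    have "2 / (q * lam) = 2 * t" "2 / (q * lam) ^ 2 = 2 * t\<^sup>2"
      by (simp_all add: t_def power_divide)
    then show ?thesis
      unfolding m_def t_def[symmetric] by (simp add: power2_eq_square algebra_simps)
  qed
  finally show ?thesis .
qed

text \<open>Case distinction on busy, idle and encodable. Each summand is now a function of the
  interarrival time times a function of the realization, so independence factors its
  expectation.\<close>

lemma compensated_eq:
  "compensated ((r, x), (a, i)) =
     (x - \<Delta> + m) * overshoot r 1 a + overshoot r 2 a / 2
     + (x - \<Delta> + m) * (overshoot r 0 a * sel (\<lambda>i. real (len i)) i)
     + overshoot r 1 a * sel (\<lambda>i. real (len i)) i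
     + overshoot r 0 a * sel (\<lambda>i. (real (len i))\<^sup>2) i / 2
     - m * x * (overshoot r 0 a * sel (\<lambda>_. 1) i) - m * (overshoot r 1 a * sel (\<lambda>_. 1) i)"
  by (auto simp: compensated_def area_def gap_def step_def starts_def idle_def overshoot_def sel_def
      power2_eq_square algebra_simps add_divide_distrib)

lemma compensated_mean_zero:
  assumes "0 \<le> fst s"
  shows "(\<integral>\<omega>. compensated (s, Z j \<omega>) \<partial>M) = 0"
proof -
  obtain r x where s: "s = (r, x)" by (cases s)
  have r: "0 \<le> r" using assms s by simp
  note int = integrable_overshoot[OF r] expectation_overshoot_sel(1)[OF r]
  let ?v = "exp (- lam * r)"
  have "(\<integral>\<omega>. compensated (s, Z j \<omega>) \<partial>M) =
     (x - \<Delta> + m) * (?v / lam) + (?v * 2 / lam\<^sup>2) / 2 + (x - \<Delta> + m) * (?v * (q * EL))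
     + ?v / lam * (q * EL) + ?v * (q * EL2) / 2 - m * x * (?v * q) - m * (?v / lam * q)"
    unfolding s Z_def compensated_eq using int
    by (simp add: expectation_overshoot(2)[OF r] expectation_overshoot_sel(2)[OF r] sum_P[simplified])
  also have "\<dots> = ?v * q * (EL2 / 2 + m\<^sup>2 - \<Delta> * m)"
  proof -
    \<comment> \<open>Eliminating \<open>lam\<close> in favour of \<open>m\<close> exposes the
      common factor \<open>?v * q\<close>; all terms containing \<open>x\<close> then
      cancel.\<close>
    have "1 / lam = q * (m - EL)"
      using q_pos' lam_pos by (simp add: m_def field_simps)
    then have *: "u / lam = u * q * (m - EL)" for u
      by (metis mult.assoc mult.commute times_divide_eq_left mult_1)
    have "(?v * 2 / lam\<^sup>2) / 2 = ?v * (q * (m - EL)) * (q * (m - EL))"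
      by (simp add: power2_eq_square * flip: divide_divide_eq_left)
    then show ?thesis
      by (simp add: * power2_eq_square algebra_simps)
  qed
  also have "\<dots> = 0"
    by (simp add: \<Delta>_times_m)
  finally show ?thesis .
qed

end

section \<open>Second moments and conclusion\<close>

text \<open>The age itself does not contract while the transmitter is busy. This majorant is reset to \<open>B\<close> at
  every encodable packet, served or not, which makes its second moments bounded.\<close>

definition age_bound_step :: "nat \<Rightarrow> real \<Rightarrow> real \<Rightarrow> real \<times> nat \<Rightarrow> real" where
  "age_bound_step k B y z = B + (if 1 \<le> snd z \<and> snd z \<le> k then 0 else y + \<bar>fst z\<bar>)"

text \<open>The delicate case is an encodable packet that arrives during a service: the majorant
  drops to \<open>B\<close>, although the packet is discarded and the age is not reset.\<close>

lemma (in sample_path)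
  assumes B: "\<And>i. 1 \<le> i \<Longrightarrow> i \<le> k \<Longrightarrow> real (len i) \<le> B" "0 \<le> B"
  shows residual_le: "fst (st j) \<le> B"
    and age_le_bound: "snd (st j) \<le> drive (age_bound_step k B) 0 (\<lambda>j. (IA j, Xr j)) j"
proof -
  let ?y = "drive (age_bound_step k B) 0 (\<lambda>j. (IA j, Xr j))"
  have y: "?y (Suc j) = B + (if 1 \<le> Xr j \<and> Xr j \<le> k then 0 else ?y j + IA j)" for j
    using IA_nonneg[of j] by (simp add: age_bound_step_def)
  have len: "real (len (Xr j)) \<le> B" if "starts k (st j) (IA j, Xr j)" for j
    using that B by (simp add: starts_def)
  show "fst (st j) \<le> B"
  proof (induction j)
    case (Suc j)
    then show ?case
      using len[of j] IA_nonneg[of j] B(2) by (auto simp: st_Suc step_def)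
  qed (simp add: st_0 B)
  \<comment> \<open>The second conjunct settles that case: during a service the age at the next
    epoch is the length of the codeword being sent, hence at most \<open>B\<close>.\<close>
  have "snd (st j) \<le> ?y j \<and> (0 < fst (st j) \<longrightarrow> snd (st j) \<le> B)"
  proof (induction j)
    case (Suc j)
    have y0: "0 \<le> ?y j"
      using Suc st_nonneg(2)[of j] by linarith
    show ?case
    proof (cases "starts k (st j) (IA j, Xr j)")
      case True
      then show ?thesis
        using len[OF True] by (simp add: y st_Suc step_def starts_def del: drive.simps)
    next
      case False
      then show ?thesis
        using Suc y0 IA_nonneg[of j] st_nonneg[of j] B(2)
        by (auto simp: y st_Suc step_def starts_def idle_def simp del: drive.simps)
    qed
  qed (simp add: st_0)
  then show "snd (st j) \<le> ?y j" ..
qed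

context status_update
begin

text \<open>Inserting 1 gives \<open>B \<ge> 1\<close>, which lets later estimates absorb lower
  order terms, for example through \<open>B \<le> B\<^sup>2\<close>.\<close>

definition B :: real where
  "B = Max (insert 1 ((\<lambda>i. real (len i)) ` {1..k}))"

lemma len_le_B: "1 \<le> i \<Longrightarrow> i \<le> k \<Longrightarrow> real (len i) \<le> B"
  unfolding B_def by (intro Max_ge) auto

lemma B_ge_1: "1 \<le> B"
  unfolding B_def by (intro Max_ge) auto

definition S :: "nat \<Rightarrow> 'a \<Rightarrow> real \<times> real" where
  "S j \<omega> = drive (step k len) (0, 0) (\<lambda>i. Z i \<omega>) j"

definition Y :: "nat \<Rightarrow> 'a \<Rightarrow> real" where
  "Y j \<omega> = drive (age_bound_step k B) 0 (\<lambda>i. Z i \<omega>) j"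

lemma S_nonneg: "0 \<le> fst (S j \<omega>)" "0 \<le> snd (S j \<omega>)"
  unfolding S_def by (induction j) (auto simp: step_def idle_def)

lemma measurable_Z[measurable]: "Z j \<in> measurable M K"
  unfolding Z_def by measurable

abbreviation "N \<equiv> (borel :: real measure) \<Otimes>\<^sub>M (borel :: real measure)"

lemma measurable_starts[measurable]:
  "Measurable.pred (N \<Otimes>\<^sub>M K) (\<lambda>p. starts k (fst p) (snd p))"
  unfolding starts_def by measurable

lemma measurable_idle[measurable]: "(\<lambda>p. idle (fst p) (snd p)) \<in> borel_measurable (N \<Otimes>\<^sub>M K)"
  unfolding idle_def by measurable

lemma measurable_gap[measurable]: "(\<lambda>p. gap k len (fst p) (snd p)) \<in> borel_measurable (N \<Otimes>\<^sub>M K)"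
  unfolding gap_def by measurable

lemma measurable_step[measurable]: "(\<lambda>p. step k len (fst p) (snd p)) \<in> measurable (N \<Otimes>\<^sub>M K) N"
  unfolding step_def by measurable

lemma measurable_case_prod_step: "case_prod (step k len) \<in> measurable (N \<Otimes>\<^sub>M K) N"
  unfolding case_prod_beta by measurable

lemma measurable_compensated: "compensated \<in> borel_measurable (N \<Otimes>\<^sub>M K)"
  unfolding compensated_def area_def by measurable

lemma measurable_age_bound_step: "case_prod (age_bound_step k B) \<in> measurable (borel \<Otimes>\<^sub>M K) borel"
  unfolding age_bound_step_def case_prod_beta by measurable

lemma measurable_S[measurable]: "S j \<in> measurable M N"
  unfolding S_def[abs_def] by (rule measurable_drive_compose[OF measurable_Z measurable_case_prod_step]) (simp add: space_pair_measure)

lemma measurable_Y[measurable]: "Y j \<in> borel_measurable M"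
  unfolding Y_def[abs_def] by (rule measurable_drive_compose[OF measurable_Z measurable_age_bound_step]) simp

lemma AE_sample_path: "AE \<omega> in M. sample_path (\<lambda>j. IA j \<omega>)"
  using AE_IA_nonneg by (simp add: sample_path_def)

lemma AE_age_le_Y: "AE \<omega> in M. snd (S j \<omega>) \<le> Y j \<omega>"
  using AE_sample_path
proof eventually_elim
  case (elim \<omega>)
  then interpret sample_path k len "\<lambda>j. IA j \<omega>" "\<lambda>j. X j \<omega>" .
  show ?case
    using age_le_bound[of B j] len_le_B B_ge_1 by (simp add: S_def Y_def st_def Z_def)
qed

section \<open>Uniform second moment bounds\<close>

lemma nn_integral_IA_power:
  "(\<integral>\<^sup>+\<omega>. ennreal (\<bar>IA j \<omega>\<bar> ^ p) \<partial>M) = ennreal (fact p / lam ^ p)"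
proof -
  have "(\<integral>\<^sup>+\<omega>. ennreal (\<bar>IA j \<omega>\<bar> ^ p) \<partial>M) = (\<integral>\<^sup>+\<omega>. ennreal (IA j \<omega> ^ p) \<partial>M)"
    using AE_IA_nonneg by (intro nn_integral_cong_AE) (auto elim!: eventually_mono)
  also have "\<dots> = ennreal (\<integral>\<omega>. IA j \<omega> ^ p \<partial>M)"
    using AE_IA_nonneg
    by (intro nn_integral_eq_integral erlang_ith_moment_integrable[OF lam_pos IA_exp])
       (auto elim!: eventually_mono)
  finally show ?thesis
    by (simp add: erlang_ith_moment[OF lam_pos IA_exp])
qed

lemma q_le_1: "q \<le> 1"
proof -
  have "q = (\<integral>\<omega>. sel (\<lambda>_. 1) (X 0 \<omega>) \<partial>M)"
    by (simp add: expectation_sel q_def)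
  also have "\<dots> \<le> (\<integral>\<omega>. 1 \<partial>M)"
    by (intro integral_mono integrable_sel) (auto simp: sel_def)
  finally show ?thesis
    by (simp add: prob_space)
qed

lemma nn_integral_not_encoded: "(\<integral>\<^sup>+\<omega>. ennreal (1 - sel (\<lambda>_. 1) (X j \<omega>)) \<partial>M) = ennreal (1 - q)"
proof -
  have "(\<integral>\<^sup>+\<omega>. ennreal (1 - sel (\<lambda>_. 1) (X j \<omega>)) \<partial>M) = ennreal (\<integral>\<omega>. 1 - sel (\<lambda>_. 1) (X j \<omega>) \<partial>M)"
    by (intro nn_integral_eq_integral Bochner_Integration.integrable_diff integrable_sel)
       (auto simp: sel_def)
  also have "(\<integral>\<omega>. 1 - sel (\<lambda>_. 1) (X j \<omega>) \<partial>M) = 1 - q"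
    using integrable_sel[of "\<lambda>_. 1" j] by (simp add: expectation_sel q_def prob_space)
  finally show ?thesis .
qed

text \<open>The inhomogeneous term of the recursion for the second moment of \<open>Y\<close>; the
  inner \<open>2 / lam\<^sup>2\<close> is the second moment of an interarrival time.\<close>

definition "c1 = (1 + 1 / q) * (2 * B\<^sup>2 + 2 * (2 / lam\<^sup>2))"

lemma c1_nonneg: "0 \<le> c1"
  using q_pos' by (simp add: c1_def)

text \<open>The majorant survives a packet only if that packet is not encodable, an event of
  probability \<open>1 - q\<close> independent of \<open>Y j\<close>. Working with nonnegative
  integrals avoids presupposing that the moments are finite.\<close>

lemma nn_integral_Y_square_Suc:
  "(\<integral>\<^sup>+\<omega>. ennreal ((Y (Suc j) \<omega>)\<^sup>2) \<partial>M) \<le>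
     ennreal c1 + ennreal (1 - q\<^sup>2) * (\<integral>\<^sup>+\<omega>. ennreal ((Y j \<omega>)\<^sup>2) \<partial>M)"
proof -
  let ?n = "\<lambda>i. 1 - sel (\<lambda>_. 1) i"
  have pw: "(Y (Suc j) \<omega>)\<^sup>2 \<le> (1 + 1 / q) * (2 * B\<^sup>2 + 2 * \<bar>IA j \<omega>\<bar>\<^sup>2) + (1 + q) * (?n (X j \<omega>) * (Y j \<omega>)\<^sup>2)" for \<omega>
  proof -
    \<comment> \<open>The weight \<open>q\<close> is chosen so that the factor \<open>1 + q\<close>,
      multiplied by the survival probability \<open>1 - q\<close>, is
      \<open>1 - q\<^sup>2 < 1\<close>.\<close>
    have young: "(a + b)\<^sup>2 \<le> (1 + 1 / q) * a\<^sup>2 + (1 + q) * b\<^sup>2" for a b :: real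
    proof -
      have "0 \<le> (a - q * b)\<^sup>2 / q"
        using q_pos' by simp
      also have "\<dots> = a\<^sup>2 / q + q * b\<^sup>2 - 2 * a * b"
        using q_pos' by (simp add: power2_eq_square field_simps)
      finally show ?thesis
        by (simp add: power2_sum algebra_simps)
    qed
    define a where "a = B + ?n (X j \<omega>) * \<bar>IA j \<omega>\<bar>"
    have Y: "Y (Suc j) \<omega> = a + ?n (X j \<omega>) * Y j \<omega>"
      by (simp add: Y_def age_bound_step_def Z_def sel_def a_def)
    have sq: "(?n (X j \<omega>) * Y j \<omega>)\<^sup>2 = ?n (X j \<omega>) * (Y j \<omega>)\<^sup>2"
      by (simp add: sel_def)
    have "a \<le> B + \<bar>IA j \<omega>\<bar>" "0 \<le> a"
      using B_ge_1 by (auto simp: a_def sel_def)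
    then have "a\<^sup>2 \<le> (B + \<bar>IA j \<omega>\<bar>)\<^sup>2"
      by (rule power_mono)
    also have "\<dots> \<le> 2 * B\<^sup>2 + 2 * \<bar>IA j \<omega>\<bar>\<^sup>2"
      using sum_squares_bound[of B "\<bar>IA j \<omega>\<bar>"] unfolding power2_sum by linarith
    finally have "(1 + 1 / q) * a\<^sup>2 \<le> (1 + 1 / q) * (2 * B\<^sup>2 + 2 * \<bar>IA j \<omega>\<bar>\<^sup>2)"
      using q_pos' by (intro mult_left_mono) auto
    then show ?thesis
      using young[of a "?n (X j \<omega>) * Y j \<omega>"] unfolding Y sq by linarith
  qed
  have n: "0 \<le> ?n i" for i
    by (simp add: sel_def)
  have "(\<integral>\<^sup>+\<omega>. ennreal ((Y (Suc j) \<omega>)\<^sup>2) \<partial>M) \<le>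
      (\<integral>\<^sup>+\<omega>. ennreal (1 + 1 / q) * (ennreal (2 * B\<^sup>2) + 2 * ennreal (\<bar>IA j \<omega>\<bar>\<^sup>2))
         + ennreal (1 + q) * ennreal (?n (X j \<omega>) * (Y j \<omega>)\<^sup>2) \<partial>M)"
    using pw q_pos' n
    by (intro nn_integral_mono)
       (simp add: ennreal_leI del: abs_power2 power2_abs flip: ennreal_plus ennreal_mult ennreal_numeral)
  also have "\<dots> = ennreal (1 + 1 / q) * (ennreal (2 * B\<^sup>2) + 2 * (\<integral>\<^sup>+\<omega>. ennreal (\<bar>IA j \<omega>\<bar>\<^sup>2) \<partial>M))
      + ennreal (1 + q) * (\<integral>\<^sup>+\<omega>. ennreal (?n (X j \<omega>) * (Y j \<omega>)\<^sup>2) \<partial>M)"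
    by (simp add: nn_integral_add nn_integral_cmult emeasure_space_1 del: abs_power2 power2_abs)
  also have "ennreal (1 + 1 / q) * (ennreal (2 * B\<^sup>2) + 2 * (\<integral>\<^sup>+\<omega>. ennreal (\<bar>IA j \<omega>\<bar>\<^sup>2) \<partial>M)) = ennreal c1"
    unfolding nn_integral_IA_power c1_def using q_pos'
    by (simp flip: ennreal_plus ennreal_mult ennreal_numeral)
  also have "(\<integral>\<^sup>+\<omega>. ennreal (?n (X j \<omega>) * (Y j \<omega>)\<^sup>2) \<partial>M) =
      (\<integral>\<^sup>+\<omega>. \<integral>\<^sup>+\<omega>'. ennreal (?n (X j \<omega>') * (Y j \<omega>)\<^sup>2) \<partial>M \<partial>M)"
    using nn_integral_drive[OF indep_Z measurable_age_bound_step _ _ Y_def,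
        of "\<lambda>p. ennreal (?n (snd (snd p)) * (fst p)\<^sup>2)" j]
    by (simp add: Z_def)
  also have "\<dots> = (\<integral>\<^sup>+\<omega>. ennreal (1 - q) * ennreal ((Y j \<omega>)\<^sup>2) \<partial>M)"
  proof (intro nn_integral_cong)
    fix \<omega>
    have "(\<integral>\<^sup>+\<omega>'. ennreal (?n (X j \<omega>') * (Y j \<omega>)\<^sup>2) \<partial>M) =
        (\<integral>\<^sup>+\<omega>'. ennreal (?n (X j \<omega>')) * ennreal ((Y j \<omega>)\<^sup>2) \<partial>M)"
      using n by (intro nn_integral_cong ennreal_mult) auto
    also have "\<dots> = (\<integral>\<^sup>+\<omega>'. ennreal (?n (X j \<omega>')) \<partial>M) * ennreal ((Y j \<omega>)\<^sup>2)"
      by (rule nn_integral_multc) measurable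
    finally show "(\<integral>\<^sup>+\<omega>'. ennreal (?n (X j \<omega>') * (Y j \<omega>)\<^sup>2) \<partial>M) = ennreal (1 - q) * ennreal ((Y j \<omega>)\<^sup>2)"
      by (simp only: nn_integral_not_encoded)
  qed
  also have "\<dots> = ennreal (1 - q) * (\<integral>\<^sup>+\<omega>. ennreal ((Y j \<omega>)\<^sup>2) \<partial>M)"
    by (rule nn_integral_cmult) measurable
  also have "ennreal (1 + q) * \<dots> = ennreal (1 - q\<^sup>2) * (\<integral>\<^sup>+\<omega>. ennreal ((Y j \<omega>)\<^sup>2) \<partial>M)"
  proof -
    have "ennreal (1 + q) * ennreal (1 - q) = ennreal ((1 + q) * (1 - q))"
      using q_pos' q_le_1 by (intro ennreal_mult[symmetric]) auto
    also have "(1 + q) * (1 - q) = 1 - q\<^sup>2"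
      by (simp add: power2_eq_square algebra_simps)
    finally show ?thesis
      by (simp only: mult.assoc[symmetric])
  qed
  finally show ?thesis .
qed

text \<open>\<open>c1 / q\<^sup>2\<close> is the fixed point of the affine recursion
  \<open>u \<mapsto> c1 + (1 - q\<^sup>2) * u\<close>, and the start value 0 lies below it.\<close>

lemma nn_integral_Y_square: "(\<integral>\<^sup>+\<omega>. ennreal ((Y j \<omega>)\<^sup>2) \<partial>M) \<le> ennreal (c1 / q\<^sup>2)"
proof (induction j)
  case (Suc j)
  have q1: "0 \<le> 1 - q\<^sup>2"
    using q_pos' q_le_1 by (simp add: power_le_one)
  have "(\<integral>\<^sup>+\<omega>. ennreal ((Y (Suc j) \<omega>)\<^sup>2) \<partial>M) \<le> ennreal c1 + ennreal (1 - q\<^sup>2) * ennreal (c1 / q\<^sup>2)"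
    using nn_integral_Y_square_Suc[of j] mult_left_mono[OF Suc, of "ennreal (1 - q\<^sup>2)"]
    by (meson add_left_mono order_trans zero_le)
  also have "\<dots> = ennreal (c1 + (1 - q\<^sup>2) * (c1 / q\<^sup>2))"
    using q1 c1_nonneg by (subst ennreal_mult[symmetric]) (auto intro!: ennreal_plus[symmetric])
  also have "c1 + (1 - q\<^sup>2) * (c1 / q\<^sup>2) = c1 / q\<^sup>2"
    using q_pos' by (simp add: field_simps)
  finally show ?case .
qed (simp add: Y_def)

lemma nn_integral_age_square: "(\<integral>\<^sup>+\<omega>. ennreal ((snd (S j \<omega>))\<^sup>2) \<partial>M) \<le> ennreal (c1 / q\<^sup>2)"
proof -
  have "(\<integral>\<^sup>+\<omega>. ennreal ((snd (S j \<omega>))\<^sup>2) \<partial>M) \<le> (\<integral>\<^sup>+\<omega>. ennreal ((Y j \<omega>)\<^sup>2) \<partial>M)"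
    using AE_age_le_Y[of j]
    by (intro nn_integral_mono_AE) (auto elim!: eventually_mono intro!: ennreal_leI power_mono simp: S_nonneg)
  then show ?thesis
    using nn_integral_Y_square[of j] by (rule order_trans)
qed

definition "c2 = 2 * B\<^sup>2 + \<bar>\<Delta>\<bar> * B + m * B"

text \<open>The gap does not exceed the interarrival time plus a codeword length, so the age enters
  only linearly while the interarrival time enters quadratically. Squaring thus calls for second
  moments of the age and fourth moments of the input.\<close>

lemma compensated_bound:
  assumes "0 \<le> fst s" "0 \<le> snd s"
  shows "\<bar>compensated (s, z)\<bar> \<le> c2 * ((1 + snd s) * (1 + \<bar>fst z\<bar>)\<^sup>2)"
proof -
  define x w t g where "x = snd s" and "w = 1 + x" and "t = 1 + \<bar>fst z\<bar>" and "g = gap k len s z"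
  have x: "0 \<le> x" and w: "1 \<le> w" and t: "1 \<le> t"
    using assms by (auto simp: x_def w_def t_def)
  have B0: "0 \<le> B" and Bsq: "B \<le> B\<^sup>2"
    using B_ge_1 by (auto simp: power2_eq_square)
  have tt: "t \<le> t\<^sup>2"
    using t by (simp add: power2_eq_square)
  have wt: "t \<le> w * t\<^sup>2" "w \<le> w * t\<^sup>2" "t\<^sup>2 \<le> w * t\<^sup>2" "w * t \<le> w * t\<^sup>2"
    using w t tt mult_mono[of 1 w t "t\<^sup>2"] mult_mono[of w w 1 "t\<^sup>2"] mult_mono[of 1 w "t\<^sup>2" "t\<^sup>2"]
    by (auto intro!: mult_left_mono)
  have idle: "idle s z \<le> \<bar>fst z\<bar>"
    using assms by (auto simp: idle_def)
  have len: "real (len (snd z)) \<le> B" if "starts k s z"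
    using that by (auto simp: starts_def intro: len_le_B)
  have "g \<le> \<bar>fst z\<bar> + B"
    using idle len B0 by (auto simp: g_def gap_def)
  also have "\<dots> \<le> B * t"
    using B_ge_1 mult_right_mono[of 1 B "\<bar>fst z\<bar>"] by (simp add: t_def algebra_simps)
  finally have g: "g \<le> B * t" .
  have g0: "0 \<le> g"
    by (simp add: g_def gap_nonneg)
  have "x * g \<le> w * (B * t)"
    using g g0 x w B0 t by (intro mult_mono) (auto simp: w_def)
  also have "\<dots> = B * (w * t)" by simp
  also have "\<dots> \<le> B\<^sup>2 * (w * t\<^sup>2)"
    using Bsq wt w t by (intro mult_mono) auto
  finally have 1: "x * g \<le> B\<^sup>2 * (w * t\<^sup>2)" .
  have "g\<^sup>2 \<le> (B * t)\<^sup>2"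
    using g g0 by (rule power_mono)
  also have "\<dots> \<le> B\<^sup>2 * (w * t\<^sup>2)"
    using wt by (auto simp: power_mult_distrib intro!: mult_left_mono)
  finally have 2: "g\<^sup>2 / 2 \<le> B\<^sup>2 * (w * t\<^sup>2)"
    using zero_le_power2[of g] by linarith
  have "\<bar>\<Delta>\<bar> * g \<le> \<bar>\<Delta>\<bar> * (B * t)"
    using g by (intro mult_left_mono) auto
  also have "\<dots> \<le> \<bar>\<Delta>\<bar> * (B * (w * t\<^sup>2))"
    using wt B0 by (intro mult_left_mono) auto
  finally have 3: "\<bar>\<Delta> * g\<bar> \<le> \<bar>\<Delta>\<bar> * (B * (w * t\<^sup>2))"
    using g0 by (simp add: abs_mult)
  have "\<bar>snd (step k len s z) - x\<bar> \<le> B * (w * t\<^sup>2)"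
  proof (cases "starts k s z")
    case True
    have "\<bar>snd (step k len s z) - x\<bar> \<le> B + x"
      using True len x by (auto simp: step_def)
    also have "\<dots> \<le> B * w"
      using B_ge_1 mult_right_mono[OF B_ge_1 x] by (simp add: w_def algebra_simps)
    also have "\<dots> \<le> B * (w * t\<^sup>2)"
      using wt B0 by (intro mult_left_mono)
    finally show ?thesis .
  next
    case False
    then have "\<bar>snd (step k len s z) - x\<bar> = idle s z"
      using idle_nonneg[of s z] by (simp add: step_def x_def)
    also have "\<dots> \<le> 1 * (w * t\<^sup>2)"
      using idle wt(1) by (simp add: t_def)
    also have "\<dots> \<le> B * (w * t\<^sup>2)"
      using B_ge_1 w by (intro mult_right_mono) auto
    finally show ?thesis .
  qed
  then have 4: "\<bar>m * (snd (step k len s z) - x)\<bar> \<le> m * (B * (w * t\<^sup>2))"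
    using m_pos by (simp add: abs_mult)
  have "compensated (s, z) = x * g + g\<^sup>2 / 2 - \<Delta> * g + m * (snd (step k len s z) - x)"
    by (simp add: compensated_def area_def x_def g_def)
  moreover have "0 \<le> x * g" "0 \<le> g\<^sup>2 / 2"
    using x g0 by auto
  ultimately have "\<bar>compensated (s, z)\<bar> \<le>
      B\<^sup>2 * (w * t\<^sup>2) + B\<^sup>2 * (w * t\<^sup>2) + \<bar>\<Delta>\<bar> * (B * (w * t\<^sup>2)) + m * (B * (w * t\<^sup>2))"
    using 1 2 3 4 by linarith
  also have "\<dots> = c2 * (w * t\<^sup>2)"
    by (simp add: c2_def algebra_simps)
  finally show ?thesis
    by (simp add: w_def t_def x_def)
qed

text \<open>The factor with \<open>c1\<close> bounds the mean of \<open>(1 + age)\<^sup>2\<close>.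
  The last factor comes from \<open>(1 + a) ^ 4 \<le> 8 + 8 * a ^ 4\<close> and the fourth moment
  \<open>24 / lam ^ 4\<close> of an interarrival time.\<close>

definition "c3 = c2\<^sup>2 * ((2 + 2 * (c1 / q\<^sup>2)) * (8 + 8 * (24 / lam ^ 4)))"

lemma nn_integral_compensated_square:
  "(\<integral>\<^sup>+\<omega>. ennreal ((compensated (S j \<omega>, Z j \<omega>))\<^sup>2) \<partial>M) \<le> ennreal c3"
proof -
  let ?u = "\<lambda>s :: real \<times> real. ennreal (2 + 2 * (snd s)\<^sup>2)"
  let ?v = "\<lambda>z :: real \<times> nat. ennreal (8 + 8 * \<bar>fst z\<bar> ^ 4)"
  have sq: "(1 + a)\<^sup>2 \<le> 2 + 2 * a\<^sup>2" for a :: real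
    using sum_squares_bound[of 1 a] by (simp add: power2_sum)
  have four: "((1 + a)\<^sup>2)\<^sup>2 \<le> 8 + 8 * a ^ 4" for a :: real
  proof -
    have "((1 + a)\<^sup>2)\<^sup>2 \<le> (2 + 2 * a\<^sup>2)\<^sup>2"
      by (rule power_mono[OF sq]) simp
    also have "\<dots> = 4 * (1 + a\<^sup>2)\<^sup>2"
      by (simp add: power2_eq_square algebra_simps)
    also have "\<dots> \<le> 4 * (2 + 2 * (a\<^sup>2)\<^sup>2)"
      by (intro mult_left_mono sq) simp
    finally show ?thesis
      by simp
  qed
  have pw: "ennreal ((compensated (S j \<omega>, Z j \<omega>))\<^sup>2) \<le> ennreal (c2\<^sup>2) * (?u (S j \<omega>) * ?v (Z j \<omega>))" for \<omega>
  proof -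
    let ?x = "snd (S j \<omega>)" and ?a = "\<bar>fst (Z j \<omega>)\<bar>"
    have "\<bar>compensated (S j \<omega>, Z j \<omega>)\<bar>\<^sup>2 \<le> (c2 * ((1 + ?x) * (1 + ?a)\<^sup>2))\<^sup>2"
      by (intro power_mono compensated_bound S_nonneg) simp
    also have "\<dots> = c2\<^sup>2 * ((1 + ?x)\<^sup>2 * ((1 + ?a)\<^sup>2)\<^sup>2)"
      by (simp only: power_mult_distrib)
    also have "\<dots> \<le> c2\<^sup>2 * ((2 + 2 * ?x\<^sup>2) * (8 + 8 * ?a ^ 4))"
      by (intro mult_left_mono mult_mono sq four) auto
    finally have "ennreal ((compensated (S j \<omega>, Z j \<omega>))\<^sup>2) \<le>
        ennreal (c2\<^sup>2 * ((2 + 2 * ?x\<^sup>2) * (8 + 8 * ?a ^ 4)))"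
      by (intro ennreal_leI) simp
    then show ?thesis
      by (simp only: ennreal_mult zero_le_power2 mult_nonneg_nonneg add_nonneg_nonneg
          zero_le_power abs_ge_zero zero_le_numeral)
  qed
  have "(\<integral>\<^sup>+\<omega>. ennreal ((compensated (S j \<omega>, Z j \<omega>))\<^sup>2) \<partial>M) \<le>
      (\<integral>\<^sup>+\<omega>. ennreal (c2\<^sup>2) * (?u (S j \<omega>) * ?v (Z j \<omega>)) \<partial>M)"
    by (intro nn_integral_mono pw)
  also have "\<dots> = ennreal (c2\<^sup>2) * (\<integral>\<^sup>+\<omega>. ?u (S j \<omega>) * ?v (Z j \<omega>) \<partial>M)"
    by (rule nn_integral_cmult) measurable
  \<comment> \<open>The state before input \<open>j\<close> is independent of \<open>Z j\<close>, so
    the expectation splits into a moment of the age and a moment of the input.\<close>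
  also have "(\<integral>\<^sup>+\<omega>. ?u (S j \<omega>) * ?v (Z j \<omega>) \<partial>M) = (\<integral>\<^sup>+\<omega>. \<integral>\<^sup>+\<omega>'. ?u (S j \<omega>) * ?v (Z j \<omega>') \<partial>M \<partial>M)"
    using nn_integral_drive[OF indep_Z measurable_case_prod_step _ _ S_def, of "\<lambda>p. ?u (fst p) * ?v (snd p)" j]
    by (simp add: space_pair_measure)
  also have "\<dots> = (\<integral>\<^sup>+\<omega>. ?u (S j \<omega>) * (\<integral>\<^sup>+\<omega>'. ?v (Z j \<omega>') \<partial>M) \<partial>M)"
    by (intro nn_integral_cong nn_integral_cmult) measurable
  also have "\<dots> = (\<integral>\<^sup>+\<omega>. ?u (S j \<omega>) \<partial>M) * (\<integral>\<^sup>+\<omega>'. ?v (Z j \<omega>') \<partial>M)"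
    by (rule nn_integral_multc) measurable
  also have "\<dots> \<le> ennreal (2 + 2 * (c1 / q\<^sup>2)) * ennreal (8 + 8 * (24 / lam ^ 4))"
  proof (rule mult_mono)
    have "(\<integral>\<^sup>+\<omega>. ?u (S j \<omega>) \<partial>M) = (\<integral>\<^sup>+\<omega>. 2 + 2 * ennreal ((snd (S j \<omega>))\<^sup>2) \<partial>M)"
      by (simp add: ennreal_plus ennreal_mult)
    also have "\<dots> = 2 + 2 * (\<integral>\<^sup>+\<omega>. ennreal ((snd (S j \<omega>))\<^sup>2) \<partial>M)"
      by (simp add: nn_integral_add nn_integral_cmult emeasure_space_1)
    also have "\<dots> \<le> 2 + 2 * ennreal (c1 / q\<^sup>2)"
      by (intro add_left_mono mult_left_mono nn_integral_age_square) simp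
    also have "\<dots> = ennreal (2 + 2 * (c1 / q\<^sup>2))"
      using c1_nonneg ennreal_mult[of 2 "c1 / q\<^sup>2"] by (subst ennreal_plus) auto
    finally show "(\<integral>\<^sup>+\<omega>. ?u (S j \<omega>) \<partial>M) \<le> ennreal (2 + 2 * (c1 / q\<^sup>2))" .
    have "(\<integral>\<^sup>+\<omega>. ?v (Z j \<omega>) \<partial>M) = (\<integral>\<^sup>+\<omega>. 8 + 8 * ennreal (\<bar>IA j \<omega>\<bar> ^ 4) \<partial>M)"
      by (simp add: ennreal_plus ennreal_mult Z_def del: power_even_abs_numeral)
    also have "\<dots> = 8 + 8 * (\<integral>\<^sup>+\<omega>. ennreal (\<bar>IA j \<omega>\<bar> ^ 4) \<partial>M)"
      by (simp add: nn_integral_add nn_integral_cmult emeasure_space_1 del: power_even_abs_numeral)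
    also have "\<dots> = ennreal (8 + 8 * (24 / lam ^ 4))"
      unfolding nn_integral_IA_power using lam_pos ennreal_mult[of 8 "24 / lam ^ 4"]
      by (subst ennreal_plus) (auto simp: fact_numeral)
    finally show "(\<integral>\<^sup>+\<omega>. ?v (Z j \<omega>) \<partial>M) \<le> ennreal (8 + 8 * (24 / lam ^ 4))"
      by simp
  qed auto
  also have "ennreal (c2\<^sup>2) * (ennreal (2 + 2 * (c1 / q\<^sup>2)) * ennreal (8 + 8 * (24 / lam ^ 4))) = ennreal c3"
    unfolding c3_def using c1_nonneg lam_pos
    by (simp only: ennreal_mult zero_le_power2 mult_nonneg_nonneg add_nonneg_nonneg divide_nonneg_nonneg
        zero_le_power less_imp_le zero_le_numeral)
  finally show ?thesis
    by (simp add: mult_left_mono)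
qed

section \<open>Almost sure limits and the average age\<close>

lemma AE_compensated_average: "AE \<omega> in M. (\<lambda>n. (\<Sum>j<n. compensated (S j \<omega>, Z j \<omega>)) / real n) \<longlonglongrightarrow> 0"
proof (rule drive_strong_law[OF indep_Z measurable_case_prod_step _ S_def measurable_compensated])
  show "(\<integral>\<omega>'. compensated (S j \<omega>, Z j \<omega>') \<partial>M) = 0" for j \<omega>
    by (rule compensated_mean_zero) (rule S_nonneg)
  show "(\<integral>\<^sup>+\<omega>. ennreal ((compensated (S j \<omega>, Z j \<omega>))\<^sup>2) \<partial>M) \<le> ennreal c3" for j
    by (rule nn_integral_compensated_square)
  show "0 \<le> c3"
    using c1_nonneg lam_pos by (auto simp: c3_def intro!: mult_nonneg_nonneg add_nonneg_nonneg)
qed (simp add: space_pair_measure)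

text \<open>The same strong law, applied to an increment that ignores the state; its second moment
  is the exponential variance.\<close>

lemma AE_IA_average: "AE \<omega> in M. (\<lambda>n. (\<Sum>j<n. IA j \<omega> - 1 / lam) / real n) \<longlonglongrightarrow> 0"
proof -
  let ?h = "\<lambda>p :: (real \<times> real) \<times> (real \<times> nat). fst (snd p) - 1 / lam"
  have "AE \<omega> in M. (\<lambda>n. (\<Sum>j<n. ?h (S j \<omega>, Z j \<omega>)) / real n) \<longlonglongrightarrow> 0"
  proof (rule drive_strong_law[OF indep_Z measurable_case_prod_step _ S_def, where C="1 / lam\<^sup>2"])
    have int: "integrable M (\<lambda>\<omega>. IA j \<omega> ^ p)" for j p
      by (rule erlang_ith_moment_integrable[OF lam_pos IA_exp])
    have mean: "expectation (IA j) = 1 / lam" for j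
      by (rule exponential_distributed_expectation[OF lam_pos IA_exp])
    show "(\<integral>\<omega>'. ?h (S j \<omega>, Z j \<omega>') \<partial>M) = 0" for j \<omega>
      using int[of j 1] by (simp add: Z_def mean prob_space)
    have sq: "integrable M (\<lambda>\<omega>. (IA j \<omega> - 1 / lam)\<^sup>2)" for j
      using int[of j 1] int[of j 2] by (simp add: power2_diff)
    show "(\<integral>\<^sup>+\<omega>. ennreal ((?h (S j \<omega>, Z j \<omega>))\<^sup>2) \<partial>M) \<le> ennreal (1 / lam\<^sup>2)" for j
      using exponential_distributed_variance[OF lam_pos IA_exp, of j]
      by (simp add: Z_def nn_integral_eq_integral[OF sq] mean)
  qed (auto simp: space_pair_measure)
  then show ?thesis
    by (simp add: Z_def)
qed

text \<open>A bounded second moment makes the second moments of the quotients summable in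
  \<open>n\<close>, so the boundary term left by telescoping is negligible.\<close>

lemma AE_age_over_index: "AE \<omega> in M. (\<lambda>n. snd (S n \<omega>) / real n) \<longlonglongrightarrow> 0"
proof (rule AE_tendsto_0_second_moment[where c="\<lambda>n. (c1 / q\<^sup>2) / (real n)\<^sup>2"])
  have sq: "integrable M (\<lambda>\<omega>. (snd (S n \<omega>))\<^sup>2)" "(\<integral>\<omega>. (snd (S n \<omega>))\<^sup>2 \<partial>M) \<le> c1 / q\<^sup>2" for n
    using c1_nonneg by (auto intro!: square_integrable_of_nn_integral[OF _ _ nn_integral_age_square])
  show "integrable M (\<lambda>\<omega>. (snd (S n \<omega>) / real n)\<^sup>2)" for n
    using sq(1) by (simp add: power_divide)
  show "(\<integral>\<omega>. (snd (S n \<omega>) / real n)\<^sup>2 \<partial>M) \<le> (c1 / q\<^sup>2) / (real n)\<^sup>2" for n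
    unfolding power_divide integral_divide_zero by (intro divide_right_mono sq(2)) simp
  show "summable (\<lambda>n. (c1 / q\<^sup>2) / (real n)\<^sup>2)"
    by (rule summable_const_over_square)
qed measurable

lemma average_age:
  "AE \<omega> in M. ((\<lambda>T. integral {0..T} (age k len (\<lambda>j. IA j \<omega>) (\<lambda>j. X j \<omega>)) / T) \<longlongrightarrow> \<Delta>) at_top"
  using AE_sample_path AE_compensated_average AE_IA_average AE_age_over_index
proof eventually_elim
  case (elim \<omega>)
  interpret sample_path k len "\<lambda>j. IA j \<omega>" "\<lambda>j. X j \<omega>"
    by (rule elim(1))
  have S: "S j \<omega> = st j" for j
    by (simp add: S_def st_def Z_def)
  have lim_0: "(\<lambda>N. c / real N) \<longlonglongrightarrow> 0" for c
    by (rule lim_const_over_n)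
  show ?case
  proof (rule average_age_tendsto)
    \<comment> \<open>An epoch exceeds the time of the last arrival by at most one codeword, so
      epochs advance by \<open>1 / lam\<close> per packet on average.\<close>
    have "(\<lambda>N. fst (st N) / real N) \<longlonglongrightarrow> 0"
    proof (rule tendsto_sandwich[OF _ _ tendsto_const lim_0[of B]])
      show "\<forall>\<^sub>F N in sequentially. fst (st N) / real N \<le> B / real N"
        using residual_le[of B] len_le_B B_ge_1 by (intro always_eventually allI divide_right_mono) auto
    qed (simp add: st_nonneg)
    from tendsto_add[OF tendsto_add[OF elim(3) this] tendsto_const[of "1 / lam"]]
    have "(\<lambda>N. (\<Sum>j<N. IA j \<omega> - 1 / lam) / real N + fst (st N) / real N + 1 / lam) \<longlonglongrightarrow> 1 / lam"
      by simp
    then show "(\<lambda>N. epoch N / real N) \<longlonglongrightarrow> 1 / lam"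
    proof (rule Lim_transform_eventually)
      show "\<forall>\<^sub>F N in sequentially. (\<Sum>j<N. IA j \<omega> - 1 / lam) / real N + fst (st N) / real N + 1 / lam
          = epoch N / real N"
        using eventually_gt_at_top[of 0]
        by eventually_elim (simp add: epoch_def sum_subtractf diff_divide_distrib add_divide_distrib)
    qed
    show "1 / lam > 0"
      using lam_pos by simp
    \<comment> \<open>The age changes add up to the final age because the initial age is 0.\<close>
    have telescope: "(\<Sum>j<N. area k len (st j) (IA j \<omega>, X j \<omega>)) - \<Delta> * epoch N =
        (\<Sum>j<N. compensated (S j \<omega>, Z j \<omega>)) - m * snd (st N)" for N
      by (induction N)
         (simp_all add: epoch_0 st_0 epoch_Suc st_Suc S Z_def compensated_def algebra_simps)
    have "(\<lambda>N. (\<Sum>j<N. compensated (S j \<omega>, Z j \<omega>)) / real N - m * (snd (S N \<omega>) / real N)) \<longlonglongrightarrow> 0 - m * 0"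
      by (intro tendsto_intros elim)
    then show "(\<lambda>N. ((\<Sum>j<N. area k len (st j) (IA j \<omega>, X j \<omega>)) - \<Delta> * epoch N) / real N) \<longlonglongrightarrow> 0"
      by (simp add: telescope diff_divide_distrib S)
  qed
qed

end

theorem theorem1:
  fixes M :: "'a measure"
    and IA :: "nat \<Rightarrow> 'a \<Rightarrow> real"
    and X :: "nat \<Rightarrow> 'a \<Rightarrow> nat"
    and P :: "nat \<Rightarrow> real"
    and len :: "nat \<Rightarrow> nat"
    and n k :: nat
    and lam :: real
  assumes "prob_space M"
    and lam_pos: "lam > 0"
    and k_range: "1 \<le> k" "k \<le> n"
    and P_nonneg: "\<And>i. 1 \<le> i \<Longrightarrow> i \<le> n \<Longrightarrow> P i \<ge> 0"
    and P_sum: "(\<Sum>i=1..n. P i) = 1"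
    and P_sorted: "\<And>m j. 1 \<le> m \<Longrightarrow> m \<le> j \<Longrightarrow> j \<le> n \<Longrightarrow> P m \<ge> P j"
    and IA_exp: "\<And>j. distributed M lborel (IA j) (exponential_density lam)"
    and X_rv: "\<And>j. X j \<in> measurable M (count_space UNIV)"
    and X_dist: "\<And>j i. 1 \<le> i \<Longrightarrow> i \<le> n \<Longrightarrow> measure M {\<omega> \<in> space M. X j \<omega> = i} = P i"
    and indep: "prob_space.indep_vars M (\<lambda>_. borel)
        (\<lambda>c. case c of Inl j \<Rightarrow> IA j | Inr j \<Rightarrow> (\<lambda>\<omega>. real (X j \<omega>))) UNIV"
  shows
    "let q = (\<Sum>i=1..k. P i);
         EL = (\<Sum>i=1..k. (P i / q) * real (len i));
         EL2 = (\<Sum>i=1..k. (P i / q) * real (len i) ^ 2)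
     in AE \<omega> in M.
          ((\<lambda>T. integral {0..T} (age k len (\<lambda>j. IA j \<omega>) (\<lambda>j. X j \<omega>)) / T)
            \<longlongrightarrow> (EL2 + 2 / (q * lam) * EL + 2 / (q * lam) ^ 2) / (2 * (EL + 1 / (q * lam))) + EL)
          at_top"
proof -
  interpret prob_space M by fact
  \<comment> \<open>The largest probability of a pmf is positive; this makes \<open>q\<close>
    positive for every \<open>k \<ge> 1\<close>.\<close>
  have "P 1 > 0"
  proof (rule ccontr)
    assume "\<not> P 1 > 0"
    then have "P i \<le> 0" if "i \<in> {1..n}" for i
      using P_sorted[of 1 i] that by auto
    then have "(\<Sum>i=1..n. P i) \<le> 0"
      by (rule sum_nonpos)
    then show False
      using P_sum by simp
  qed
  also have "P 1 \<le> (\<Sum>i=1..k. P i)"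
    using k_range P_nonneg by (intro member_le_sum) auto
  finally interpret status_update M IA X P len k lam
    using assms by unfold_locales auto
  show ?thesis
    using average_age
    unfolding Let_def \<Delta>_def m_def EL_def EL2_def q_def by simp
qed

end
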